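(* Let $\mathfrak m$ be an infinite cardinal satisfying $\sup\{\mathfrak m^{\mathfrak n} : \mathfrak n<\mathfrak m\}=\mathfrak m$. Suppose a topological group $G$ of weight $\mathfrak m$ has the property that the intersection of every family of strictly less than $\mathfrak m$ open subsets of $G$ is open. (Sometimes such groups are called $P_{\mathfrak m}$-groups.) Then $G$ is isomorphic (as a topological group) with a topological subgroup of $\mathrm{Iso}(\mathbb U_{\mathfrak m})$.
   Context: For an infinite cardinal $\mathfrak m$ with $\sup\{\mathfrak m^{\mathfrak n}:\mathfrak n<\mathfrak m\}=\mathfrak m$, $\mathbb U_{\mathfrak m}$ denotes the Urysohn--Katětov space: the complete metric space of weight $\mathfrak m$, unique up to isometry (Katětov), which contains an isometric copy of every metric space of weight $\le\mathfrak m$ and is $<\mathfrak m$-homogeneous, that is, every isometry between two metric subspaces of density $<\mathfrak m$ extends to a self-isometry of the whole space $\mathbb U_{\mathfrak m}$. For $\mathfrak m=\aleph_0$ it is the classical Urysohn space. $\mathrm{Iso}(\mathbb U_{\mathfrak m})$ is the group of isometries of $\mathbb U_{\mathfrak m}$ with the topology of simple (pointwise) convergence on $\mathbb U_{\mathfrak m}$; a neighbourhood basis at the identity consists of the sets $\{g : d(x_i,gx_i)<\varepsilon,\ i=1,\dots,n\}$ with $x_1,\dots,x_n\in\mathbb U_{\mathfrak m}$ and $\varepsilon>0$. The weight of a topological space is the smallest cardinality of a base; the density is the smallest cardinality of a dense subset.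
   Formalization: The topological group G is assumed to be Hausdorff; this is a common convention and is forced by the conclusion, since Iso(U_m) is Hausdorff (a discrete group of size m times an indiscrete two-element group would be a counterexample). *)

theory Defs
  imports "HOL-Analysis.Analysis" "HOL-Algebra.Bij"
begin

unbundle cardinal_syntax

text \<open>
  Cardinals are the well-orders of type \<open>'k rel\<close> satisfying \<^const>\<open>Card_order\<close>; they are compared
  across types by \<open>\<le>o\<close>, \<open><o\<close> and \<open>=o\<close>.
\<close>

subsection \<open>Weight and density\<close>

definition base_of_topology :: "'a topology \<Rightarrow> 'a set set \<Rightarrow> bool" where
  "base_of_topology X \<B> \<longleftrightarrow>
     (\<forall>V\<in>\<B>. openin X V) \<and> (\<forall>U x. openin X U \<and> x \<in> U \<longrightarrow> (\<exists>V\<in>\<B>. x \<in> V \<and> V \<subseteq> U))"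

definition dense_in_topology :: "'a topology \<Rightarrow> 'a set \<Rightarrow> bool" where
  "dense_in_topology X D \<longleftrightarrow> D \<subseteq> topspace X \<and> X closure_of D = topspace X"

definition weight :: "'a topology \<Rightarrow> 'a set rel" where
  "weight X = |SOME \<B>. base_of_topology X \<B> \<and> (\<forall>\<B>'. base_of_topology X \<B>' \<longrightarrow> |\<B>| \<le>o |\<B>'| )|"

definition density :: "'a topology \<Rightarrow> 'a rel" where
  "density X = |SOME D. dense_in_topology X D \<and> (\<forall>D'. dense_in_topology X D' \<longrightarrow> |D| \<le>o |D'| )|"

lemma ex_least_card_of:
  assumes "P (A :: 'a set)"
  shows "\<exists>B. P B \<and> (\<forall>C. P C \<longrightarrow> |B| \<le>o |C| )"
proof -
  let ?R = "{|C| | C. P C}"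
  have "?R \<noteq> {}" "\<forall>r\<in>?R. Card_order r"
    using assms by (auto simp: card_of_Card_order)
  from exists_minim_Card_order[OF this] show ?thesis by blast
qed

lemma weight_attained:
  obtains \<B> where "base_of_topology X \<B>" "weight X = |\<B>|"
    "\<And>\<B>'. base_of_topology X \<B>' \<Longrightarrow> |\<B>| \<le>o |\<B>'|"
proof -
  have "base_of_topology X {U. openin X U}"
    by (auto simp: base_of_topology_def)
  from someI_ex[OF ex_least_card_of[where P = "base_of_topology X", OF this]] show thesis
    by (intro that) (auto simp: weight_def)
qed

lemma density_attained:
  obtains D where "dense_in_topology X D" "density X = |D|"
    "\<And>D'. dense_in_topology X D' \<Longrightarrow> |D| \<le>o |D'|"
proof -
  have "dense_in_topology X (topspace X)"
    by (auto simp: dense_in_topology_def)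
  from someI_ex[OF ex_least_card_of[where P = "dense_in_topology X", OF this]] show thesis
    by (intro that) (auto simp: density_def)
qed


subsection \<open>Suprema of cardinals\<close>

text \<open>
  It suffices to test upper bounds \<open>s\<close> on the type of \<open>m\<close>: a cardinal on any other type that is not
  \<open>\<ge> m\<close> is \<open>< m\<close>, hence equinumerous with a cardinal on the type of \<open>m\<close>.
\<close>

definition is_cardinal_sup :: "'a rel set \<Rightarrow> 'k rel \<Rightarrow> bool" where
  "is_cardinal_sup S m \<longleftrightarrow> Card_order m \<and> (\<forall>c\<in>S. c \<le>o m) \<and>
     (\<forall>s :: 'k rel. Card_order s \<and> (\<forall>c\<in>S. c \<le>o s) \<longrightarrow> m \<le>o s)"


subsection \<open>Topological groups\<close>

definition topological_group :: "('g, 'b) monoid_scheme \<Rightarrow> 'g topology \<Rightarrow> bool" where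
  "topological_group G T \<longleftrightarrow>
     group G \<and> topspace T = carrier G \<and>
     continuous_map (prod_topology T T) T (\<lambda>(x, y). x \<otimes>\<^bsub>G\<^esub> y) \<and>
     continuous_map T T (\<lambda>x. inv\<^bsub>G\<^esub> x)"

text \<open>
  The intersection is taken inside the whole space, so the empty family yields
  \<^term>\<open>topspace T\<close>.
\<close>

definition P_space :: "'k rel \<Rightarrow> 'a topology \<Rightarrow> bool" where
  "P_space m T \<longleftrightarrow>
     (\<forall>\<U>. (\<forall>U\<in>\<U>. openin T U) \<and> |\<U>| <o m \<longrightarrow> openin T (topspace T \<inter> \<Inter>\<U>))"

definition topological_group_iso ::
  "('g, 'b) monoid_scheme \<Rightarrow> 'g topology \<Rightarrow> ('h, 'c) monoid_scheme \<Rightarrow> 'h topology \<Rightarrow> ('g \<Rightarrow> 'h) \<Rightarrow> bool"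
  where
  "topological_group_iso G T H S \<phi> \<longleftrightarrow> \<phi> \<in> iso G H \<and> homeomorphic_map T S \<phi>"


subsection \<open>Isometries and the isometry group\<close>

definition isometric_embedding :: "'a metric \<Rightarrow> 'b metric \<Rightarrow> ('a \<Rightarrow> 'b) \<Rightarrow> bool" where
  "isometric_embedding M N f \<longleftrightarrow>
     f \<in> mspace M \<rightarrow> mspace N \<and> (\<forall>x\<in>mspace M. \<forall>y\<in>mspace M. mdist N (f x) (f y) = mdist M x y)"

definition isometry :: "'a metric \<Rightarrow> 'b metric \<Rightarrow> ('a \<Rightarrow> 'b) \<Rightarrow> bool" where
  "isometry M N f \<longleftrightarrow> isometric_embedding M N f \<and> f ` mspace M = mspace N"

definition Iso :: "'u metric \<Rightarrow> ('u \<Rightarrow> 'u) monoid" where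
  "Iso U = (BijGroup (mspace U))\<lparr>carrier := {g \<in> Bij (mspace U). isometry U U g}\<rparr>"

definition Iso_topology :: "'u metric \<Rightarrow> ('u \<Rightarrow> 'u) topology" where
  "Iso_topology U =
     subtopology (product_topology (\<lambda>_. mtopology_of U) (mspace U)) (carrier (Iso U))"

lemma topspace_Iso_topology: "topspace (Iso_topology U) = carrier (Iso U)"
  by (auto simp: Iso_topology_def Iso_def Bij_def isometry_def isometric_embedding_def
      PiE_def Pi_def)

lemma subgroup_Iso: "subgroup (carrier (Iso U)) (BijGroup (mspace U))"
proof
  let ?S = "mspace U"
  interpret group "BijGroup ?S" by (rule group_BijGroup)
  show "carrier (Iso U) \<subseteq> carrier (BijGroup ?S)"
    by (auto simp: Iso_def BijGroup_def)
  show "\<one>\<^bsub>BijGroup ?S\<^esub> \<in> carrier (Iso U)"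
    by (auto simp: Iso_def BijGroup_def id_Bij isometry_def isometric_embedding_def)
  show "g \<otimes>\<^bsub>BijGroup ?S\<^esub> h \<in> carrier (Iso U)" 
    if "g \<in> carrier (Iso U)" "h \<in> carrier (Iso U)" for g h
    using that compose_Bij[of g ?S h]
    by (auto simp: Iso_def BijGroup_def isometry_def isometric_embedding_def compose_def Pi_def
        image_image Bij_def bij_betw_def)
  show "inv\<^bsub>BijGroup ?S\<^esub> g \<in> carrier (Iso U)" if g: "g \<in> carrier (Iso U)" for g
  proof -
    have B: "g \<in> Bij ?S" and iso: "isometry U U g" 
      using g by (auto simp: Iso_def)
    have bij: "bij_betw g ?S ?S" using B by (simp add: Bij_def)
    let ?h = "\<lambda>x\<in>?S. inv_into ?S g x"
    have hB: "?h \<in> Bij ?S" using B by (rule restrict_inv_into_Bij)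
    have mem: "inv_into ?S g x \<in> ?S" if "x \<in> ?S" for x
      using Bij_inv_into_mem[OF B that] .
    have "mdist U (inv_into ?S g x) (inv_into ?S g y) = mdist U x y" if "x \<in> ?S" "y \<in> ?S" for x y
      using iso that mem bij_betw_inv_into_right[OF bij]
      unfolding isometry_def isometric_embedding_def by metis
    then have "isometry U U ?h"
      using hB mem by (auto simp: isometry_def isometric_embedding_def Bij_def bij_betw_def)
    then show ?thesis using hB inv_BijGroup[OF B] by (simp add: Iso_def)
  qed
qed

lemma group_Iso: "group (Iso U)"
proof -
  have "Iso U = (BijGroup (mspace U))\<lparr>carrier := carrier (Iso U)\<rparr>"
    by (simp add: Iso_def)
  then show ?thesis
    by (metis group.subgroup_imp_group group_BijGroup subgroup_Iso)
qed


subsection \<open>The Urysohn--Katetov space\<close>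

text \<open>
  Universality refers to metric spaces of arbitrary size, but a definition can only quantify over
  metric spaces on one type. A metric space of weight at most an infinite cardinal \<open>m :: 'k rel\<close> has
  at most \<open>m\<close> to the power \<open>\<aleph>\<^sub>0\<close> points, so it has an isometric copy on the type \<open>nat \<Rightarrow> 'k\<close>. Lemma
  \<open>universal_metric_embedding\<close> below recovers universality for metric spaces on every type.
\<close>

definition universal_metric :: "'k rel \<Rightarrow> 'u metric \<Rightarrow> bool" where
  "universal_metric m U \<longleftrightarrow>
     (\<forall>M :: (nat \<Rightarrow> 'k) metric. weight (mtopology_of M) \<le>o m \<longrightarrow> (\<exists>f. isometric_embedding M U f))"

lemma weight_le_card_of_base:
  assumes "base_of_topology X \<B>"
  shows "weight X \<le>o |\<B>|"
  using weight_attained[of X] assms by metis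

lemma weight_le_of_homeomorphic_map:
  assumes "homeomorphic_map X Y f" 
  shows "weight Y \<le>o weight X"
proof -
  obtain \<B> where B: "base_of_topology X \<B>" and w: "weight X = |\<B>|"
    by (rule weight_attained[of X])
  have "base_of_topology Y ((`) f ` \<B>)"
    unfolding base_of_topology_def
  proof (intro conjI ballI allI impI)
    fix V assume "V \<in> (`) f ` \<B>"
    then show "openin Y V"
      using B homeomorphic_imp_open_map[OF assms]
      by (auto simp: base_of_topology_def open_map_def)
  next
    fix W y assume W: "openin Y W \<and> y \<in> W"
    then have "y \<in> f ` topspace X"
      using assms homeomorphic_imp_surjective_map openin_subset by blast
    then obtain x where x: "x \<in> topspace X" "y = f x" by auto
    have "openin X {x \<in> topspace X. f x \<in> W}"
      using assms W homeomorphic_imp_continuous_map openin_continuous_map_preimage by blast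
    then obtain V where "V \<in> \<B>" "x \<in> V" "V \<subseteq> {x \<in> topspace X. f x \<in> W}"
      using B x W unfolding base_of_topology_def
      by (metis (mono_tags, lifting) mem_Collect_eq)
    then show "\<exists>V\<in>(`) f ` \<B>. y \<in> V \<and> V \<subseteq> W"
      using x by blast
  qed
  from weight_le_card_of_base[OF this] card_of_image[of "(`) f" \<B>] show ?thesis
    unfolding w by (rule ordLeq_transitive)
qed

lemma universal_metric_embedding:
  fixes m :: "'k rel" and M :: "'a metric" and U :: "'u metric"
  assumes univ: "universal_metric m U" and "Cinfinite m"
    and M: "weight (mtopology_of M) \<le>o m"
  shows "\<exists>f. isometric_embedding M U f"
proof -
  let ?S = "mspace M" and ?d = "mdist M"
  interpret M: Metric_space ?S ?d by (rule Metric_space_mspace_mdist)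
  have top: "mtopology_of M = M.mtopology" by (simp add: mtopology_of_def)
  obtain \<B> where B: "base_of_topology M.mtopology \<B>" and w: "weight (mtopology_of M) = |\<B>|"
    unfolding top by (rule weight_attained)
  have "|\<B>| \<le>o |Field m|"
    using M[unfolded w] ordIso_symmetric[OF card_of_Field_ordIso[of m]] assms(2)
    by (blast intro: ordLeq_ordIso_trans)
  then obtain e :: "'a set \<Rightarrow> 'k" where e: "inj_on e \<B>"
    using card_of_ordLeq[of \<B> "Field m"] by blast
  have "\<exists>V\<in>\<B>. x \<in> V \<and> V \<subseteq> M.mball x (inverse (real (Suc n)))" if "x \<in> ?S" for x n
  proof -
    have "openin M.mtopology (M.mball x (inverse (real (Suc n))))" 
      "x \<in> M.mball x (inverse (real (Suc n)))"
      using that by auto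
    then show ?thesis using B unfolding base_of_topology_def by blast
  qed
  then obtain V where V: "\<And>x n. x \<in> ?S \<Longrightarrow> 
      V x n \<in> \<B> \<and> x \<in> V x n \<and> V x n \<subseteq> M.mball x (inverse (real (Suc n)))"
    by metis
  define h where "h = (\<lambda>x n. e (V x n))"
  have h: "inj_on h ?S"
  proof
    fix x y assume x: "x \<in> ?S" and y: "y \<in> ?S" and "h x = h y"
    then have "e (V x n) = e (V y n)" for n
      by (auto simp: h_def dest: fun_cong)
    then have "V x n = V y n" for n
      using inj_onD[OF e, of "V x n" "V y n"] V[OF x, of n] V[OF y, of n] by simp
    then have less: "?d x y < inverse (real (Suc n))" for n
      using V[OF x, of n] V[OF y, of n] by auto
    have "\<not> 0 < ?d x y"
      using less reals_Archimedean[of "?d x y"] by (blast dest: less_asym)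
    then show "x = y" using x y M.nonneg[of x y] by (simp add: M.zero less_le)
  qed
  define k where "k = inv_into ?S h"
  have k: "k (h x) = x" if "x \<in> ?S" for x using h that by (simp add: k_def)
  define N where "N = metric (h ` ?S, \<lambda>a b. if a \<in> h ` ?S \<and> b \<in> h ` ?S then ?d (k a) (k b) else 0)"
  interpret N: Metric_space "h ` ?S" "\<lambda>a b. if a \<in> h ` ?S \<and> b \<in> h ` ?S then ?d (k a) (k b) else 0"
    by unfold_locales (auto simp: k M.commute M.triangle)
  have N: "mspace N = h ` ?S" "\<And>x y. x \<in> ?S \<Longrightarrow> y \<in> ?S \<Longrightarrow> mdist N (h x) (h y) = ?d x y"
    by (auto simp: N_def k)
  interpret MN: Metric_space12 ?S ?d "h ` ?S" "\<lambda>a b. if a \<in> h ` ?S \<and> b \<in> h ` ?S then ?d (k a) (k b) else 0" ..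
  have "homeomorphic_map M.mtopology N.mtopology h"
    by (rule MN.isometry_imp_homeomorphic_map) (auto simp: k)
  then have "weight (mtopology_of N) \<le>o weight (mtopology_of M)"
    unfolding N_def N.mtopology_of top by (rule weight_le_of_homeomorphic_map)
  then have "weight (mtopology_of N) \<le>o m"
    using M by (rule ordLeq_transitive)
  then obtain f where "isometric_embedding N U f"
    using univ unfolding universal_metric_def by blast
  then have "isometric_embedding M U (f \<circ> h)"
    by (auto simp: isometric_embedding_def N Pi_def)
  then show ?thesis by blast
qed

definition homogeneous_metric :: "'k rel \<Rightarrow> 'u metric \<Rightarrow> bool" where
  "homogeneous_metric m U \<longleftrightarrow>
     (\<forall>A B f. A \<subseteq> mspace U \<and> B \<subseteq> mspace U \<and>
        density (mtopology_of (submetric U A)) <o m \<and>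
        density (mtopology_of (submetric U B)) <o m \<and>
        isometry (submetric U A) (submetric U B) f \<longrightarrow>
        (\<exists>g\<in>carrier (Iso U). \<forall>x\<in>A. g x = f x))"

definition Urysohn_Katetov :: "'k rel \<Rightarrow> 'u metric \<Rightarrow> bool" where
  "Urysohn_Katetov m U \<longleftrightarrow>
     mcomplete_of U \<and> weight (mtopology_of U) =o m \<and>
     universal_metric m U \<and> homogeneous_metric m U"

end

theory Submission
  imports Defs
begin

text \<open>
  The group \<open>G\<close> acts isometrically, by left translations, on a disjoint union of copies of itself, one for
  each \<open>V\<close> in a neighbourhood base at the identity; the copy belonging to \<open>V\<close> carries a left-invariant
  continuous pseudometric in which a ball around the identity lies in \<open>V\<close>. Onto this space a tower of
  length \<open>m\<close> is built, whose points are terms prescribing their distances to fewer than \<open>m\<close> earlier points.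
  The action extends to the tower because the construction is natural. It stays continuous because a point
  moves little once the fewer than \<open>m\<close> points prescribing it do, and that is an open condition on \<open>g \<in> G\<close> by
  the \<open>P\<^sub>m\<close> property. The tower has density at most \<open>m\<close> and, \<open>m\<close> being regular, it realizes every Katetov
  function on fewer than \<open>m\<close> of its points, as does the Urysohn--Katetov space. A back-and-forth argument
  between dense sets embeds the tower densely into \<open>U\<close>, and the action passes to the completion \<open>U\<close>.

  Only a pseudometric on the tower is needed, and the tower itself need not be complete: back-and-forth uses
  exact realization on each side but the resulting isometry is extended by completeness of \<open>U\<close> alone.
\<close>

subsection \<open>Infinite cardinals closed under smaller powers\<close>

text \<open>Three demands compete: the tower must realize every Katetov function on fewer than m
  points, its density must not exceed m, and G must move each of its points continuously. Supports
  of size below m reconcile them. The hypothesis on powers bounds the number of rational data on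
  such a support by m and also makes m regular, so that a small set of points lies below a single
  level; and fewer than m neighbourhoods of the identity still intersect in a neighbourhood.

  Points are formal trees instead of functions, so that the group acts by relabelling leaves and the
  laws of an action hold as equations between terms, without choices or quotients. Distinct terms at
  distance 0 do no harm: they receive the same image in U. Each node can magnify errors by a factor
  4, which induction on terms absorbs.

  A copy of G for every V is taken because G may fail to be metrizable: one continuous
  left-invariant pseudometric need not induce its topology.\<close>

locale power_closed_cardinal =
  fixes m :: "'k rel"
  assumes Cinfinite: "Cinfinite m"
    and power_le: "\<And>n :: 'k rel. Card_order n \<Longrightarrow> n <o m \<Longrightarrow> m ^c n \<le>o m"
begin

lemma Card_order: "Card_order m" and infinite_Field: "infinite (Field m)"
  using Cinfinite by (auto simp: cinfinite_def)

lemma Well_order: "Well_order m"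
  using Card_order card_order_on_well_order_on by blast

definition below :: "'k \<Rightarrow> 'k \<Rightarrow> bool" (infix "\<sqsubset>" 50)
  where "a \<sqsubset> b \<longleftrightarrow> (a, b) \<in> m \<and> a \<noteq> b"

lemma wf_below: "wf {(a, b). a \<sqsubset> b}"
proof -
  have "{(a, b). a \<sqsubset> b} = m - Id" by (auto simp: below_def)
  then show ?thesis using Well_order by (simp add: well_order_on_def)
qed

lemma below_trans: "a \<sqsubset> b \<Longrightarrow> b \<sqsubset> c \<Longrightarrow> a \<sqsubset> c"
  using wo_rel.TRANS[of m] wo_rel.ANTISYM[of m] Well_order
  unfolding below_def wo_rel_def by (meson antisymD transD)

lemma below_irrefl [simp]: "\<not> a \<sqsubset> a"
  by (simp add: below_def)

lemma below_asym: "a \<sqsubset> b \<Longrightarrow> \<not> b \<sqsubset> a"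
  using below_trans below_irrefl by blast

lemma below_Field: "a \<sqsubset> b \<Longrightarrow> a \<in> Field m \<and> b \<in> Field m"
  by (auto simp: below_def Field_def)

lemma below_total: "a \<in> Field m \<Longrightarrow> b \<in> Field m \<Longrightarrow> a \<sqsubset> b \<or> a = b \<or> b \<sqsubset> a"
  using wo_rel.TOTALS[of m] Well_order by (auto simp: below_def wo_rel_def)

lemma card_below: "a \<in> Field m \<Longrightarrow> |{b. b \<sqsubset> a}| <o m"
proof -
  assume "a \<in> Field m"
  moreover have "{b. b \<sqsubset> a} = underS m a" by (auto simp: below_def underS_def)
  ultimately show ?thesis using card_of_underS[OF Card_order] by simp
qed

text \<open>The closed segment will index the data of a node. It is nonempty even at the least
  element, and \<open>a\<close> itself serves as the distinguished index in
  \<open>kext\<close>.\<close>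

definition segment :: "'k \<Rightarrow> 'k set"
  where "segment a = insert a {b. b \<sqsubset> a}"

lemma segment_self [simp]: "a \<in> segment a"
  by (simp add: segment_def)

lemma segment_Field: "a \<in> Field m \<Longrightarrow> segment a \<subseteq> Field m"
  by (auto simp: segment_def below_Field)

section \<open>Cardinalities below m and at most m\<close>

lemma finite_card_less: "finite A \<Longrightarrow> |A| <o m"
  using Well_order infinite_Field
  by (intro finite_ordLess_infinite card_of_Well_order) (auto simp: Field_card_of)

lemma card_Un_less: "|A| <o m \<Longrightarrow> |B| <o m \<Longrightarrow> |A \<union> B| <o m"
  using card_of_Un_ordLess_infinite_Field[OF infinite_Field Card_order] .

lemma card_image_less: "|A| <o m \<Longrightarrow> |f ` A| <o m"
  by (rule ordLeq_ordLess_trans[OF card_of_image])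

lemma card_segment: "a \<in> Field m \<Longrightarrow> |segment a| <o m"
proof -
  assume "a \<in> Field m"
  then have "|{a} \<union> {b. b \<sqsubset> a}| <o m"
    by (intro card_Un_less card_below finite_card_less) auto
  then show ?thesis by (simp add: segment_def)
qed

lemma card_Field: "|Field m| =o m"
  using card_of_Field_ordIso[OF Card_order] .

lemma card_le_mI: "A \<subseteq> Field m \<Longrightarrow> |A| \<le>o m"
  by (rule ordLeq_ordIso_trans[OF card_of_mono1 card_Field])

lemma card_image_le: "|A| \<le>o m \<Longrightarrow> |f ` A| \<le>o m"
  by (rule ordLeq_transitive[OF card_of_image])

lemma card_subset_le: "A \<subseteq> B \<Longrightarrow> |B| \<le>o m \<Longrightarrow> |A| \<le>o m"
  by (rule ordLeq_transitive[OF card_of_mono1])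

lemma countable_card_le: "countable A \<Longrightarrow> |A| \<le>o m"
proof -
  assume "countable A"
  then have "|A| \<le>o natLeq"
    by (meson card_of_nat card_of_ordLeq countableE subset_UNIV ordLeq_ordIso_trans)
  then show ?thesis using natLeq_ordLeq_cinfinite[OF Cinfinite] ordLeq_transitive by blast
qed

lemma card_Times_le: "|A| \<le>o m \<Longrightarrow> |B| \<le>o m \<Longrightarrow> |A \<times> B| \<le>o m"
  using card_of_Times_ordLeq_infinite_Field[OF infinite_Field _ _ Card_order] .

lemma card_Un_le: "|A| \<le>o m \<Longrightarrow> |B| \<le>o m \<Longrightarrow> |A \<union> B| \<le>o m"
  using card_of_Un_ordLeq_infinite_Field[OF infinite_Field _ _ Card_order] .

lemma card_UN_le: "|A| \<le>o m \<Longrightarrow> (\<And>a. a \<in> A \<Longrightarrow> |B a| \<le>o m) \<Longrightarrow> |\<Union>a\<in>A. B a| \<le>o m"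
  using card_of_UNION_ordLeq_infinite_Field[OF infinite_Field Card_order] by blast

text \<open>The power hypothesis in the form used for counting. The exponent must be a cardinal on
  the type of m, hence \<open>A\<close> is taken inside \<open>Field m\<close>, while
  \<open>B\<close> may live on any type.\<close>

lemma card_Func_le:
  assumes "A \<subseteq> Field m" "|A| <o m" and B: "|B| \<le>o m"
  shows "|Func A B| \<le>o m"
proof -
  have "|Func A B| = |B| ^c |A|"
    by (simp add: cexp_def Field_card_of)
  also have "|B| ^c |A| \<le>o m ^c |A|"
    using B card_of_Card_order by (rule cexp_mono1)
  also have "m ^c |A| \<le>o m"
    using power_le assms(2) card_of_Card_order by blast
  finally show ?thesis .
qed

text \<open>Diagonalising against an enumeration of the functions from a small cofinal set to \<^term>\<open>m\<close>.\<close>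

lemma small_bounded:
  assumes A: "A \<subseteq> Field m" "|A| <o m"
  shows "\<exists>b\<in>Field m. \<forall>a\<in>A. a \<sqsubset> b"
proof (rule ccontr)
  assume "\<not> ?thesis"
  then have cof: "\<exists>a\<in>A. \<not> a \<sqsubset> b" if "b \<in> Field m" for b
    using that by blast
  have "|Func A (Field m)| \<le>o |Field m|"
    using card_Func_le[OF A card_le_mI[OF order_refl]] card_Field
    by (rule ordLeq_ordIso_trans[OF _ ordIso_symmetric])
  moreover have "Func A (Field m) \<noteq> {}"
    using infinite_Field by (auto simp: Func_is_emp)
  ultimately obtain \<phi> where \<phi>: "\<phi> ` Field m = Func A (Field m)"
    using card_of_ordLeq2[of "Func A (Field m)" "Field m"] by blast
  have "\<exists>y\<in>Field m. \<forall>\<xi>. \<xi> \<sqsubset> a \<or> \<xi> = a \<longrightarrow> \<phi> \<xi> a \<noteq> y" if "a \<in> A" for a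
  proof (rule ccontr)
    assume "\<not> ?thesis"
    then have "Field m \<subseteq> (\<lambda>\<xi>. \<phi> \<xi> a) ` segment a"
      by (fastforce simp: segment_def)
    then have "|Field m| \<le>o |(\<lambda>\<xi>. \<phi> \<xi> a) ` segment a|"
      by (rule card_of_mono1)
    moreover have "|(\<lambda>\<xi>. \<phi> \<xi> a) ` segment a| <o m"
      using that A by (intro card_image_less card_segment) auto
    ultimately have "|Field m| <o m"
      using ordLeq_ordLess_trans by blast
    then show False using card_Field not_ordLess_ordIso by blast
  qed
  then obtain h where h: "\<And>a. a \<in> A \<Longrightarrow> h a \<in> Field m"
    "\<And>a \<xi>. a \<in> A \<Longrightarrow> \<xi> \<sqsubset> a \<or> \<xi> = a \<Longrightarrow> \<phi> \<xi> a \<noteq> h a"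
    by metis
  have "(\<lambda>a. if a \<in> A then h a else undefined) \<in> Func A (Field m)"
    using h by (auto simp: Func_def)
  then have "(\<lambda>a. if a \<in> A then h a else undefined) \<in> \<phi> ` Field m"
    using \<phi> by simp
  then obtain \<xi> where \<xi>: "\<xi> \<in> Field m" "\<phi> \<xi> = (\<lambda>a. if a \<in> A then h a else undefined)"
    by (elim imageE) simp
  obtain a where "a \<in> A" "\<not> a \<sqsubset> \<xi>"
    using cof[OF \<xi>(1)] by blast
  then have "\<phi> \<xi> a \<noteq> h a"
    using h(2) below_total \<xi>(1) A by blast
  then show False using \<xi> \<open>a \<in> A\<close> by simp
qed

text \<open>Inject \<open>J\<close> into \<open>Field m\<close>; by regularity some \<open>a\<close>
  bounds both this image and all labels \<open>l j\<close>. So \<open>J\<close> embeds into the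
  segment of \<open>a\<close> and is in turn a surjective image of it. This re-indexes an arbitrary
  small family in the format that \<open>Node\<close> demands.\<close>

lemma small_segment_surj:
  assumes "|J| <o m" "J \<noteq> {}" "l ` J \<subseteq> Field m"
  obtains a e where "a \<in> Field m" "e ` segment a = J" "\<And>j. j \<in> J \<Longrightarrow> l j \<sqsubset> a"
proof -
  have "|J| \<le>o |Field m|"
    using ordLess_imp_ordLeq[OF assms(1)] ordIso_symmetric[OF card_Field]
    by (rule ordLeq_ordIso_trans)
  then obtain f where f: "inj_on f J" "f ` J \<subseteq> Field m"
    using card_of_ordLeq[of J "Field m"] by blast
  have "|f ` J \<union> l ` J| <o m"
    using assms by (intro card_Un_less card_image_less)
  then obtain a where a: "a \<in> Field m" "\<And>b. b \<in> f ` J \<union> l ` J \<Longrightarrow> b \<sqsubset> a"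
    using small_bounded[of "f ` J \<union> l ` J"] f assms by blast
  have "f ` J \<subseteq> segment a" using a by (auto simp: segment_def)
  then have "\<exists>e. e ` segment a = J"
    using f(1) card_of_ordLeq[of J "segment a"] card_of_ordLeq2[OF assms(2), of "segment a"] by blast
  then show thesis using that a by blast
qed

end

subsection \<open>Continuous norms on topological groups\<close>

locale topgroup =
  fixes G :: "('g, 'b) monoid_scheme" (structure) and T :: "'g topology"
  assumes topological_group: "topological_group G T"
begin

sublocale group G
  using topological_group by (simp add: topological_group_def)

lemma topspace_eq: "topspace T = carrier G"
  using topological_group by (simp add: topological_group_def)

lemma open_carrier: "openin T (carrier G)"
  using topspace_eq openin_topspace by metis

lemma open_subset: "openin T V \<Longrightarrow> V \<subseteq> carrier G"
  using openin_subset topspace_eq by blast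

lemma open_inv:
  assumes "openin T V" shows "openin T {x \<in> carrier G. inv x \<in> V}"
  using topological_group openin_continuous_map_preimage[OF _ assms, of T "\<lambda>x. inv x"]
  by (simp add: topological_group_def)

lemma open_translate:
  assumes "openin T V" "a \<in> carrier G" shows "openin T {x \<in> carrier G. a \<otimes> x \<in> V}"
proof -
  have "continuous_map T (prod_topology T T) (\<lambda>x. (a, x))"
    using assms topspace_eq by (auto simp: continuous_map_pairwise o_def)
  then have "continuous_map T T ((\<lambda>(x, y). x \<otimes> y) \<circ> (\<lambda>x. (a, x)))"
    using topological_group continuous_map_compose unfolding topological_group_def by blast
  then have "continuous_map T T (\<lambda>x. a \<otimes> x)"
    by (simp add: o_def)
  from openin_continuous_map_preimage[OF this assms(1)] show ?thesis
    by (simp add: topspace_eq)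
qed

lemma mult_nbhd:
  assumes "openin T V" "\<one> \<in> V"
  obtains W where "openin T W" "\<one> \<in> W" "\<And>x y. x \<in> W \<Longrightarrow> y \<in> W \<Longrightarrow> x \<otimes> y \<in> V"
proof -
  let ?P = "{p \<in> topspace (prod_topology T T). (\<lambda>(x, y). x \<otimes> y) p \<in> V}"
  have "openin (prod_topology T T) ?P"
    using topological_group assms(1) unfolding topological_group_def
    by (blast intro: openin_continuous_map_preimage)
  moreover have "(\<one>, \<one>) \<in> ?P"
    using assms topspace_eq by auto
  ultimately obtain A B where AB: "openin T A" "openin T B" "\<one> \<in> A" "\<one> \<in> B" "A \<times> B \<subseteq> ?P"
    using openin_prod_topology_alt[of T T ?P] by meson
  show thesis
    by (rule that[of "A \<inter> B"]) (use AB in auto)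
qed

definition sym_nbhd :: "'g set \<Rightarrow> bool"
  where "sym_nbhd V \<longleftrightarrow> openin T V \<and> \<one> \<in> V \<and> (\<forall>x\<in>V. inv x \<in> V)"

lemma sym_nbhd_carrier: "sym_nbhd (carrier G)"
  by (simp add: sym_nbhd_def open_carrier)

lemma ex_sym_nbhd:
  assumes "openin T V" "\<one> \<in> V"
  obtains W where "sym_nbhd W" "W \<subseteq> V"
proof
  let ?W = "V \<inter> {x \<in> carrier G. inv x \<in> V}"
  show "sym_nbhd ?W"
    using assms open_inv[OF assms(1)] by (auto simp: sym_nbhd_def)
  show "?W \<subseteq> V" by blast
qed

text \<open>Triple products are needed because words will be cut into a left part, one letter and a
  right part.\<close>

lemma ex_cube_nbhd:
  assumes V: "sym_nbhd V"
  obtains W where "sym_nbhd W" "\<And>x y z. x \<in> W \<Longrightarrow> y \<in> W \<Longrightarrow> z \<in> W \<Longrightarrow> x \<otimes> y \<otimes> z \<in> V"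
proof -
  have V': "openin T V" "\<one> \<in> V" using V by (auto simp: sym_nbhd_def)
  obtain A where A: "openin T A" "\<one> \<in> A" "\<And>x y. x \<in> A \<Longrightarrow> y \<in> A \<Longrightarrow> x \<otimes> y \<in> V"
    using mult_nbhd[OF V'] by blast
  obtain B where B: "openin T B" "\<one> \<in> B" "\<And>x y. x \<in> B \<Longrightarrow> y \<in> B \<Longrightarrow> x \<otimes> y \<in> A"
    using mult_nbhd[OF A(1,2)] by blast
  obtain W where W: "sym_nbhd W" "W \<subseteq> A \<inter> B"
    using ex_sym_nbhd[of "A \<inter> B"] A B by blast
  show thesis
  proof (rule that[OF W(1)])
    fix x y z assume "x \<in> W" "y \<in> W" "z \<in> W"
    then show "x \<otimes> y \<otimes> z \<in> V"
      using W A(3)[of "x \<otimes> y" z] B(3)[of x y] by blast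
  qed
qed

text \<open>Starting the sequence with the whole group bounds the resulting norm by 1.\<close>

lemma ex_nbhd_sequence:
  assumes "openin T V" "\<one> \<in> V"
  obtains W :: "nat \<Rightarrow> 'g set" where "W 0 = carrier G" "W (Suc 0) \<subseteq> V" "\<And>n. sym_nbhd (W n)"
    "\<And>n x y z. x \<in> W (Suc n) \<Longrightarrow> y \<in> W (Suc n) \<Longrightarrow> z \<in> W (Suc n) \<Longrightarrow> x \<otimes> y \<otimes> z \<in> W n"
proof -
  obtain S where S: "sym_nbhd S" "S \<subseteq> V"
    using ex_sym_nbhd[OF assms] by blast
  have "\<exists>W'. sym_nbhd W' \<and> (\<forall>x\<in>W'. \<forall>y\<in>W'. \<forall>z\<in>W'. x \<otimes> y \<otimes> z \<in> W)" if "sym_nbhd W" for W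
    by (rule ex_cube_nbhd[OF that]) blast
  then obtain f where f: "\<And>W. sym_nbhd W \<Longrightarrow> sym_nbhd (f W)"
    "\<And>W x y z. sym_nbhd W \<Longrightarrow> x \<in> f W \<Longrightarrow> y \<in> f W \<Longrightarrow> z \<in> f W \<Longrightarrow> x \<otimes> y \<otimes> z \<in> W"
    unfolding Bex_def Ball_def by metis
  define W where "W n = (case n of 0 \<Rightarrow> carrier G | Suc k \<Rightarrow> (f ^^ k) S)" for n
  have sym: "sym_nbhd ((f ^^ k) S)" for k
    by (induction k) (auto simp: S f)
  have W: "sym_nbhd (W n)" for n
    using sym sym_nbhd_carrier by (auto simp: W_def split: nat.split)
  have "x \<otimes> y \<otimes> z \<in> W n" if "x \<in> W (Suc n)" "y \<in> W (Suc n)" "z \<in> W (Suc n)" for n x y z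
  proof (cases n)
    case 0
    have "W (Suc n) \<subseteq> carrier G" using W open_subset unfolding sym_nbhd_def by blast
    then show ?thesis using that 0 by (auto simp: W_def)
  next
    case (Suc k)
    then show ?thesis using that f(2)[OF sym, of x k y z] by (simp add: W_def)
  qed
  then show thesis using that[of W] W S by (simp add: W_def)
qed

section \<open>Words over a sequence of neighbourhoods and their costs\<close>

inductive word :: "(nat \<Rightarrow> 'g set) \<Rightarrow> nat \<Rightarrow> real \<Rightarrow> 'g \<Rightarrow> bool" for W where
  word_one: "word W 0 0 \<one>"
| word_step: "word W k q g \<Longrightarrow> h \<in> W n \<Longrightarrow> word W (Suc k) (q + (1/2)^n) (g \<otimes> h)"

context
  fixes W :: "nat \<Rightarrow> 'g set"
  assumes W0: "W 0 = carrier G"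
    and sym: "\<And>n. sym_nbhd (W n)"
    and cube: "\<And>n x y z. x \<in> W (Suc n) \<Longrightarrow> y \<in> W (Suc n) \<Longrightarrow> z \<in> W (Suc n) \<Longrightarrow> x \<otimes> y \<otimes> z \<in> W n"
begin

lemma W_carrier: "x \<in> W n \<Longrightarrow> x \<in> carrier G"
  using sym open_subset unfolding sym_nbhd_def by blast

lemma W_one: "\<one> \<in> W n" and W_inv: "x \<in> W n \<Longrightarrow> inv x \<in> W n" and W_open: "openin T (W n)"
  using sym unfolding sym_nbhd_def by blast+

lemma W_antimono: "n \<le> n' \<Longrightarrow> W n' \<subseteq> W n"
proof (induction n' rule: dec_induct)
  case (step k)
  have "W (Suc k) \<subseteq> W k"
    using cube[of _ k \<one> \<one>] W_one W_carrier by fastforce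
  then show ?case using step by blast
qed auto

lemma word_carrier: "word W k q g \<Longrightarrow> g \<in> carrier G" and word_nonneg: "word W k q g \<Longrightarrow> 0 \<le> q"
  by (induction rule: word.induct) (auto simp: W_carrier)

lemma word_mult:
  assumes "word W k q g" "word W l r h"
  shows "word W (k + l) (q + r) (g \<otimes> h)"
  using assms(2,1)
proof (induction rule: word.induct)
  case word_one
  then show ?case using word_carrier by simp
next
  case (word_step l r h h' n)
  have "word W (Suc (k + l)) (q + r + (1/2)^n) (g \<otimes> h \<otimes> h')"
    using word_step by (intro word.word_step) auto
  then show ?case
    using word_step word_carrier W_carrier by (simp add: m_assoc add.assoc)
qed

lemma word_single: "h \<in> W n \<Longrightarrow> word W (Suc 0) ((1/2)^n) h"
  using word_step[OF word_one, of h W n] W_carrier by simp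

lemma word_inv: "word W k q g \<Longrightarrow> word W k q (inv g)"
proof (induction rule: word.induct)
  case word_one
  then show ?case using word.word_one by simp
next
  case (word_step k q g h n)
  have "word W (Suc 0 + k) ((1/2)^n + q) (inv h \<otimes> inv g)"
    using word_step W_inv by (intro word_mult word_single) auto
  then show ?case
    using word_step word_carrier W_carrier by (simp add: inv_mult_group add.commute)
qed

text \<open>The letter \<open>h\<close> is the one at which the accumulated cost first reaches the
  threshold \<open>t\<close>. Hence the part before it costs less than \<open>t\<close>, and the
  part after it at most \<open>q - t\<close>.\<close>

lemma word_split:
  assumes "word W k q g" "0 < t" "t \<le> q"
  shows "\<exists>k1 q1 g1 n h k2 q2 g2. word W k1 q1 g1 \<and> h \<in> W n \<and> word W k2 q2 g2 \<and> k1 < k \<and> k2 < k \<and>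
    g = g1 \<otimes> h \<otimes> g2 \<and> q = q1 + (1/2)^n + q2 \<and> q1 < t \<and> t \<le> q1 + (1/2)^n"
  using assms
proof (induction rule: word.induct)
  case (word_step k q g h n)
  show ?case
  proof (cases "t \<le> q")
    case True
    obtain k1 q1 g1 n' h' k2 q2 g2 where *: "word W k1 q1 g1" "h' \<in> W n'" "word W k2 q2 g2" "k1 < k" "k2 < k"
      "g = g1 \<otimes> h' \<otimes> g2" "q = q1 + (1/2)^n' + q2" "q1 < t" "t \<le> q1 + (1/2)^n'"
      using word_step.IH[OF word_step.prems(1) True] by blast
    have "g \<otimes> h = g1 \<otimes> h' \<otimes> (g2 \<otimes> h)"
      using * word_carrier W_carrier word_step by (simp add: m_assoc)
    moreover have "word W (Suc k2) (q2 + (1/2)^n) (g2 \<otimes> h)"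
      using * word_step by (intro word.word_step)
    moreover have "q + (1/2)^n = q1 + (1/2)^n' + (q2 + (1/2)^n)"
      using * by simp
    ultimately show ?thesis
      using * less_SucI Suc_less_eq by blast
  next
    case False
    have "g \<otimes> h = g \<otimes> h \<otimes> \<one>"
      using word_step word_carrier W_carrier by simp
    moreover have "q + (1/2)^n = q + (1/2)^n + 0" by simp
    moreover have "word W 0 0 \<one>" by (rule word.word_one)
    ultimately show ?thesis
      using word_step False by (metis lessI zero_less_Suc not_le)
  qed
qed simp

text \<open>Induction on the number of letters. A word of cost at least half of
  \<open>(1/2)^n\<close> is split at that half: both outer parts cost less than the half, and the
  middle letter, costing less than \<open>(1/2)^n\<close>, comes from a set inside
  \<open>W (Suc n)\<close>; \<open>cube\<close> multiplies the three. For a cheaper word it is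
  enough to detach the last letter.\<close>

lemma word_in_W: "word W k q g \<Longrightarrow> q < (1/2)^n \<Longrightarrow> g \<in> W n"
proof (induction k arbitrary: q g n rule: less_induct)
  case (less k)
  show ?case
  proof (cases "q < (1/2)^Suc n")
    case True
    show ?thesis
    proof (cases k)
      case 0
      then show ?thesis using less.prems(1) W_one by (auto elim: word.cases)
    next
      case (Suc k')
      then obtain q' g' h n' where *: "word W k' q' g'" "h \<in> W n'" "q = q' + (1/2)^n'" "g = g' \<otimes> h"
        using less.prems(1) by (auto elim: word.cases)
      have "(1/2::real)^n' < (1/2)^Suc n" "q' < (1/2)^Suc n"
        using * True word_nonneg[OF *(1)] zero_less_power[of "1/2::real" n'] by linarith+
      then have "Suc n < n'"
        using power_strict_decreasing_iff[of "1/2::real" n' "Suc n"] by simp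
      then have "h \<in> W (Suc n)" using W_antimono[of "Suc n" n'] * by auto
      moreover have "g' \<in> W (Suc n)"
        using less.IH[of k' q' g' "Suc n"] Suc * \<open>q' < _\<close> by simp
      ultimately show ?thesis
        using cube[of g' n h \<one>] W_one W_carrier * by simp
    qed
  next
    case False
    obtain k1 q1 g1 n' h k2 q2 g2 where *: "word W k1 q1 g1" "h \<in> W n'" "word W k2 q2 g2" "k1 < k" "k2 < k"
      "g = g1 \<otimes> h \<otimes> g2" "q = q1 + (1/2)^n' + q2" "q1 < (1/2)^Suc n" "(1/2)^Suc n \<le> q1 + (1/2)^n'"
      using word_split[OF less.prems(1), of "(1/2)^Suc n"] False by auto
    have "q2 < (1/2)^Suc n" using * less.prems by simp
    have "(1/2::real)^n' < (1/2)^n"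
      using * less.prems word_nonneg[OF *(1)] word_nonneg[OF *(3)] by linarith
    then have "n < n'" using power_strict_decreasing_iff[of "1/2::real" n' n] by simp
    then have "h \<in> W (Suc n)" using W_antimono[of "Suc n" n'] * by auto
    then show ?thesis
      using cube less.IH[OF *(4,1,8)] less.IH[OF *(5,3) \<open>q2 < _\<close>] * by simp
  qed
qed

end

text \<open>
  Birkhoff--Kakutani: the norm of \<open>g\<close> is the infimum of the costs of words for \<open>g\<close>, a letter from \<open>W n\<close>
  costing \<open>(1/2)^n\<close>.
\<close>

lemma ex_norm:
  assumes "openin T V" "\<one> \<in> V"
  obtains N :: "'g \<Rightarrow> real"
  where "N \<one> = 0" "\<And>g. g \<in> carrier G \<Longrightarrow> 0 \<le> N g \<and> N g \<le> 1"
    "\<And>g h. g \<in> carrier G \<Longrightarrow> h \<in> carrier G \<Longrightarrow> N (g \<otimes> h) \<le> N g + N h"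
    "\<And>g. g \<in> carrier G \<Longrightarrow> N (inv g) = N g"
    "\<And>g. g \<in> carrier G \<Longrightarrow> N g < 1/2 \<Longrightarrow> g \<in> V"
    "\<And>e. 0 < e \<Longrightarrow> \<exists>W. openin T W \<and> \<one> \<in> W \<and> (\<forall>g\<in>W. N g < e)"
proof -
  obtain W :: "nat \<Rightarrow> 'g set" where W: "W 0 = carrier G" "W (Suc 0) \<subseteq> V" "\<And>n. sym_nbhd (W n)"
    "\<And>n x y z. x \<in> W (Suc n) \<Longrightarrow> y \<in> W (Suc n) \<Longrightarrow> z \<in> W (Suc n) \<Longrightarrow> x \<otimes> y \<otimes> z \<in> W n"
    using ex_nbhd_sequence[OF assms] by blast
  note sequence = W(1,3,4)
  define Q where "Q g = {q. \<exists>k. word W k q g}" for g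
  define N where "N g = Inf (Q g)" for g
  have bdd: "bdd_below (Q g)" for g
    using word_nonneg[where W = W, OF sequence] unfolding Q_def by (auto intro: bdd_belowI[of _ 0])
  have le: "N g \<le> q" if "word W k q g" for g k q
    unfolding N_def using that bdd by (auto intro!: cInf_lower simp: Q_def)
  have single: "N g \<le> (1/2)^n" if "g \<in> W n" for g n
    using le word_single[where W = W, OF sequence that] by blast
  have ne: "Q g \<noteq> {}" if "g \<in> carrier G" for g
    using word_single[where W = W, OF sequence, of g 0] that W(1) by (auto simp: Q_def)
  have less: "\<exists>k q. word W k q g \<and> q < c" if "g \<in> carrier G" "N g < c" for g c
    using cInf_lessD[OF ne[OF that(1)], of c] that(2) by (auto simp: N_def Q_def)
  have nonneg: "0 \<le> N g" if "g \<in> carrier G" for g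
    unfolding N_def using ne[OF that] word_nonneg[where W = W, OF sequence] by (auto intro!: cInf_greatest simp: Q_def)
  have Q_inv: "Q g \<subseteq> Q (inv g)" for g
    using word_inv[where W = W, OF sequence] unfolding Q_def by blast
  show thesis
  proof
    show "N \<one> = 0" using le[OF word_one] nonneg[of \<one>] by simp
    show "0 \<le> N g \<and> N g \<le> 1" if "g \<in> carrier G" for g
      using nonneg[OF that] single[of g 0] that W(1) by simp
    show "N (inv g) = N g" if "g \<in> carrier G" for g
    proof -
      have "Q (inv g) = Q g" using Q_inv[of g] Q_inv[of "inv g"] that by simp
      then show ?thesis by (simp add: N_def)
    qed
    show "N (g \<otimes> h) \<le> N g + N h" if g: "g \<in> carrier G" and h: "h \<in> carrier G" for g h
    proof (rule field_le_epsilon)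
      fix e :: real assume e: "0 < e"
      obtain k q where q: "word W k q g" "q < N g + e/2"
        using less[OF g, of "N g + e/2"] e by auto
      obtain l r where r: "word W l r h" "r < N h + e/2"
        using less[OF h, of "N h + e/2"] e by auto
      show "N (g \<otimes> h) \<le> N g + N h + e"
        using le[OF word_mult[where W = W, OF sequence q(1) r(1)]] q r by simp
    qed
    \<comment> \<open>The threshold 1/2 is the cost of a letter from \<open>W 1\<close>, which is
      contained in \<open>V\<close>.\<close>
    show "g \<in> V" if "g \<in> carrier G" "N g < 1/2" for g
      using less[OF that] word_in_W[where W = W, OF sequence, of _ _ g 1] W(2) by auto
    show "\<exists>W. openin T W \<and> \<one> \<in> W \<and> (\<forall>g\<in>W. N g < e)" if e: "0 < e" for e
    proof -
      obtain n where "(1/2::real)^n < e"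
        using real_arch_pow_inv[OF e, of "1/2"] by auto
      then show ?thesis
        using single[of _ n] W_open[where W = W, OF sequence, of n] W_one[where W = W, OF sequence, of n]
        by (intro exI[of _ "W n"]) (auto intro: le_less_trans)
    qed
  qed
qed

end

subsection \<open>Katetov functions\<close>

definition pseudometric_on :: "'a set \<Rightarrow> ('a \<Rightarrow> 'a \<Rightarrow> real) \<Rightarrow> bool" where
  "pseudometric_on X d \<longleftrightarrow>
     (\<forall>x\<in>X. d x x = 0) \<and> (\<forall>x\<in>X. \<forall>y\<in>X. 0 \<le> d x y \<and> d x y = d y x) \<and>
     (\<forall>x\<in>X. \<forall>y\<in>X. \<forall>z\<in>X. d x z \<le> d x y + d y z)"

lemma pseudometric_onD:
  assumes "pseudometric_on X d" "x \<in> X" "y \<in> X"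
  shows "d x x = 0" "0 \<le> d x y" "d x y = d y x" "z \<in> X \<Longrightarrow> d x z \<le> d x y + d y z"
  using assms unfolding pseudometric_on_def by blast+

text \<open>Each axiom speaks of at most three points.\<close>

lemma pseudometric_on_finite_character:
  assumes "\<And>F. finite F \<Longrightarrow> F \<subseteq> X \<Longrightarrow> \<exists>Y. F \<subseteq> Y \<and> pseudometric_on Y d"
  shows "pseudometric_on X d"
proof -
  have 1: "d x x = 0 \<and> 0 \<le> d x y \<and> d x y = d y x \<and> d x z \<le> d x y + d y z"
    if xyz: "x \<in> X" "y \<in> X" "z \<in> X" for x y z
  proof -
    obtain Y where Y: "{x, y, z} \<subseteq> Y" "pseudometric_on Y d"
      using assms[of "{x, y, z}"] xyz by auto
    show ?thesis using pseudometric_onD[OF Y(2), of x y] Y(1) by simp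
  qed
  show ?thesis unfolding pseudometric_on_def by (intro conjI ballI) (use 1 in blast)+
qed

definition katetov_on :: "'a set \<Rightarrow> ('a \<Rightarrow> 'a \<Rightarrow> real) \<Rightarrow> ('a \<Rightarrow> real) \<Rightarrow> bool" where
  "katetov_on X d f \<longleftrightarrow> (\<forall>x\<in>X. \<forall>y\<in>X. f x \<le> f y + d x y \<and> d x y \<le> f x + f y)"

lemma katetov_onD:
  assumes "katetov_on X d f" "x \<in> X" "y \<in> X"
  shows "f x \<le> f y + d x y" "d x y \<le> f x + f y"
  using assms unfolding katetov_on_def by blast+

text \<open>A point \<open>t\<close> of \<open>N\<close> is represented by the Katetov function
  \<open>d t\<close> on \<open>L\<close>, and the last assumption makes distances within
  \<open>N\<close> uniform distances between such functions. Points with the same function end up at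
  distance 0.\<close>

lemma pseudometric_on_extend:
  assumes L: "pseudometric_on L d" "L \<noteq> {}"
    and N: "\<And>t. t \<in> N \<Longrightarrow> katetov_on L d (d t)"
    and sym: "\<And>t z. t \<in> N \<Longrightarrow> z \<in> L \<Longrightarrow> d z t = d t z"
    and sup: "\<And>t u. t \<in> N \<Longrightarrow> u \<in> N \<Longrightarrow> d t u = (SUP z\<in>L. \<bar>d t z - d u z\<bar>)"
  shows "pseudometric_on (L \<union> N) d"
proof -
  note Ld = pseudometric_onD[OF L(1)]
  note Nd = katetov_onD[OF N]
  have nonneg: "0 \<le> d t z" if "t \<in> N" "z \<in> L" for t z
    using Nd(2)[OF that(1) that(2) that(2)] Ld(1)[OF that(2) that(2)] by simp
  \<comment> \<open>This estimate through an arbitrary \<open>w\<close> in \<open>L\<close> has two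
    uses: it makes the suprema finite, and it is the triangle inequality between points of
    \<open>N\<close> by way of \<open>L\<close>.\<close>
  have diff: "\<bar>d t z - d u z\<bar> \<le> d t w + d u w" if "t \<in> N" "u \<in> N" "z \<in> L" "w \<in> L" for t u z w
    using Nd[OF that(1) that(3) that(4)] Nd[OF that(2) that(3) that(4)] Nd[OF that(1) that(4) that(3)]
      Nd[OF that(2) that(4) that(3)] by linarith
  obtain w where w: "w \<in> L" using L(2) by blast
  have upper: "\<bar>d t z - d u z\<bar> \<le> d t u" if "t \<in> N" "u \<in> N" "z \<in> L" for t u z
    unfolding sup[OF that(1,2)]
    using that diff w by (intro cSUP_upper) (auto intro!: bdd_aboveI2)
  have least: "d t u \<le> c" if "t \<in> N" "u \<in> N" "\<And>z. z \<in> L \<Longrightarrow> \<bar>d t z - d u z\<bar> \<le> c" for t u c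
    unfolding sup[OF that(1,2)] using L(2) that(3) by (rule cSUP_least)
  have refl: "d t t = 0" if "t \<in> N" for t
    using least[OF that that, of 0] upper[OF that that w] by simp
  have nonnegN: "0 \<le> d t u" if "t \<in> N" "u \<in> N" for t u
    using upper[OF that w] by simp
  have symN: "d t u = d u t" if "t \<in> N" "u \<in> N" for t u
    unfolding sup[OF that] sup[OF that(2,1)] by (simp add: abs_minus_commute)
  have triNNN: "d t v \<le> d t u + d u v" if "t \<in> N" "u \<in> N" "v \<in> N" for t u v
  proof (rule least[OF that(1,3)])
    fix z assume "z \<in> L"
    then show "\<bar>d t z - d v z\<bar> \<le> d t u + d u v"
      using upper[OF that(1,2)] upper[OF that(2,3)] by fastforce
  qed
  have triNLN: "d t v \<le> d t z + d v z" if "t \<in> N" "v \<in> N" "z \<in> L" for t v z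
    using that diff by (intro least)
  have triNNL: "d t z \<le> d t u + d u z" if "t \<in> N" "u \<in> N" "z \<in> L" for t u z
    using upper[OF that] by simp
  have triLLN: "d t x \<le> d t y + d x y" "d x y \<le> d t x + d t y" if "t \<in> N" "x \<in> L" "y \<in> L" for t x y
    using Nd[OF that] by auto
  have "d x x = 0" if "x \<in> L \<union> N" for x
    using that refl Ld(1) by blast
  moreover have "0 \<le> d x y \<and> d x y = d y x" if "x \<in> L \<union> N" "y \<in> L \<union> N" for x y
    using that nonneg nonnegN sym symN Ld(2,3) by (metis UnE)
  moreover have "d x z \<le> d x y + d y z" if xyz: "x \<in> L \<union> N" "y \<in> L \<union> N" "z \<in> L \<union> N" for x y z
  proof -
    consider "x \<in> L" "y \<in> L" "z \<in> L" | "x \<in> L" "y \<in> L" "z \<in> N" | "x \<in> L" "y \<in> N" "z \<in> L"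
      | "x \<in> L" "y \<in> N" "z \<in> N" | "x \<in> N" "y \<in> L" "z \<in> L" | "x \<in> N" "y \<in> L" "z \<in> N"
      | "x \<in> N" "y \<in> N" "z \<in> L" | "x \<in> N" "y \<in> N" "z \<in> N"
      using xyz by blast
    then show ?thesis
    proof cases
      case 1 then show ?thesis using Ld(4) by blast
    next
      case 2 then show ?thesis using triLLN(1)[of z x y] sym[of z x] sym[of z y] by simp
    next
      case 3 then show ?thesis using triLLN(2)[of y x z] sym[of y x] by simp
    next
      case 4 then show ?thesis using triNNL[of z y x] sym[of z x] sym[of y x] symN[of y z] by simp
    next
      case 5 then show ?thesis using triLLN(1)[of x z y] Ld(3)[of y z] by simp
    next
      case 6 then show ?thesis using triNLN[of x z y] sym[of z y] by simp
    next
      case 7 then show ?thesis using triNNL by simp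
    next
      case 8 then show ?thesis using triNNN by simp
    qed
  qed
  ultimately show ?thesis unfolding pseudometric_on_def by blast
qed

text \<open>
  A Katetov function built from arbitrary prescribed values \<open>r i\<close> at the points \<open>s i\<close>. It attains them
  whenever they are consistent, and it depends continuously on \<open>s\<close> and \<open>r\<close> in any case. The clamping at a
  distinguished index \<open>a\<close> keeps the infimum and the supremum finite for unbounded families.
\<close>

definition clamp :: "('a \<Rightarrow> 'a \<Rightarrow> real) \<Rightarrow> 'i \<Rightarrow> ('i \<Rightarrow> 'a) \<Rightarrow> ('i \<Rightarrow> real) \<Rightarrow> 'i \<Rightarrow> real" where
  "clamp d a s r i = max (r i) (d (s i) (s a) - r a)"

definition kext :: "('a \<Rightarrow> 'a \<Rightarrow> real) \<Rightarrow> 'i set \<Rightarrow> 'i \<Rightarrow> ('i \<Rightarrow> 'a) \<Rightarrow> ('i \<Rightarrow> real) \<Rightarrow> 'a \<Rightarrow> real" where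
  "kext d I a s r x =
     max (INF i\<in>I. clamp d a s r i + d x (s i)) (SUP i\<in>I. d x (s i) - clamp d a s r i)"

text \<open>\<open>kext\<close> sees its metric only through the distances from \<open>x\<close> to
  the \<open>s i\<close> and from the \<open>s i\<close> to \<open>s a\<close>. This locality closes
  the recursion defining \<open>node_value\<close> and later transports distances along
  isometries.\<close>

lemma kext_cong:
  assumes "\<And>i. i \<in> I \<Longrightarrow> d x (s i) = d' x' (s' i)" "\<And>i. i \<in> I \<Longrightarrow> d (s i) (s a) = d' (s' i) (s' a)"
    "\<And>i. i \<in> I \<Longrightarrow> r i = r' i" "a \<in> I"
  shows "kext d I a s r x = kext d' I a s' r' x'"
  unfolding kext_def clamp_def using assms
  by (intro arg_cong2[where f = max] arg_cong[where f = Inf] arg_cong[where f = Sup] image_cong) auto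

lemma abs_diff_Inf_le:
  fixes f g :: "'i \<Rightarrow> real"
  assumes "I \<noteq> {}" "bdd_below (f ` I)" "bdd_below (g ` I)" "\<And>i. i \<in> I \<Longrightarrow> \<bar>f i - g i\<bar> \<le> e"
  shows "\<bar>(INF i\<in>I. f i) - (INF i\<in>I. g i)\<bar> \<le> e"
proof -
  have "(INF i\<in>I. f i) - e \<le> g i" "(INF i\<in>I. g i) - e \<le> f i" if "i \<in> I" for i
    using assms(4)[OF that] cINF_lower[OF assms(2) that] cINF_lower[OF assms(3) that] by linarith+
  then have "(INF i\<in>I. f i) - e \<le> (INF i\<in>I. g i)" "(INF i\<in>I. g i) - e \<le> (INF i\<in>I. f i)"
    using assms(1) by (simp_all add: cINF_greatest)
  then show ?thesis by (simp add: abs_le_iff)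
qed

lemma abs_diff_Sup_le:
  fixes f g :: "'i \<Rightarrow> real"
  assumes "I \<noteq> {}" "bdd_above (f ` I)" "bdd_above (g ` I)" "\<And>i. i \<in> I \<Longrightarrow> \<bar>f i - g i\<bar> \<le> e"
  shows "\<bar>(SUP i\<in>I. f i) - (SUP i\<in>I. g i)\<bar> \<le> e"
proof -
  have "f i \<le> (SUP i\<in>I. g i) + e" "g i \<le> (SUP i\<in>I. f i) + e" if "i \<in> I" for i
    using assms(4)[OF that] cSUP_upper[OF that assms(2)] cSUP_upper[OF that assms(3)] by linarith+
  then have "(SUP i\<in>I. f i) \<le> (SUP i\<in>I. g i) + e" "(SUP i\<in>I. g i) \<le> (SUP i\<in>I. f i) + e"
    using assms(1) by (simp_all add: cSUP_least)
  then show ?thesis by (simp add: abs_le_iff)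
qed

context
  fixes X :: "'a set" and d :: "'a \<Rightarrow> 'a \<Rightarrow> real" and I :: "'i set" and a :: 'i
  assumes X: "pseudometric_on X d" and a: "a \<in> I"
begin

text \<open>Clamping forces \<open>clamp d a s r i \<ge> d (s i) (s a) - r a\<close>, so that
  \<open>- r a\<close> and \<open>d x (s a) + r a\<close> are bounds independent of
  \<open>i\<close>.\<close>

lemma clamp_bounds:
  assumes "s ` I \<subseteq> X" "x \<in> X"
  shows "bdd_below ((\<lambda>i. clamp d a s r i + d x (s i)) ` I)"
    "bdd_above ((\<lambda>i. d x (s i) - clamp d a s r i) ` I)"
proof -
  have s: "s i \<in> X" if "i \<in> I" for i using assms that by blast
  have "- r a \<le> clamp d a s r i + d x (s i)" if "i \<in> I" for i
    using pseudometric_onD(2)[OF X s[OF that] s[OF a]] pseudometric_onD(2)[OF X assms(2) s[OF that]]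
    by (simp add: clamp_def)
  then show "bdd_below ((\<lambda>i. clamp d a s r i + d x (s i)) ` I)"
    by (rule bdd_belowI2)
  have "d x (s i) - clamp d a s r i \<le> d x (s a) + r a" if "i \<in> I" for i
    using pseudometric_onD(4)[OF X assms(2) s[OF a] s[OF that]] pseudometric_onD(3)[OF X s[OF that] s[OF a]]
    by (simp add: clamp_def)
  then show "bdd_above ((\<lambda>i. d x (s i) - clamp d a s r i) ` I)"
    by (rule bdd_aboveI2)
qed

text \<open>The infimum and the supremum are 1-Lipschitz because their members are. The second
  Katetov inequality pairs the infimum at \<open>x\<close> with the supremum at \<open>y\<close>:
  for each \<open>i\<close> the triangle inequality through \<open>s i\<close> compares the two
  members, and the maximum dominates both halves.\<close>

lemma kext_katetov:
  assumes s: "s ` I \<subseteq> X"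
  shows "katetov_on X d (kext d I a s r)"
  unfolding katetov_on_def
proof (intro ballI conjI)
  fix x y assume x: "x \<in> X" and y: "y \<in> X"
  note Xd = pseudometric_onD[OF X]
  define f g where "f x = (INF i\<in>I. clamp d a s r i + d x (s i))"
    and "g x = (SUP i\<in>I. d x (s i) - clamp d a s r i)" for x
  have I: "I \<noteq> {}" using a by blast
  have sX: "s i \<in> X" if "i \<in> I" for i using s that by blast
  have close: "\<bar>d x (s i) - d y (s i)\<bar> \<le> d x y" if "i \<in> I" for i
    using Xd(4)[OF x y sX[OF that]] Xd(4)[OF y x sX[OF that]] Xd(3)[OF x y] by simp
  have f: "\<bar>f x - f y\<bar> \<le> d x y"
    unfolding f_def using close x y s
    by (intro abs_diff_Inf_le I clamp_bounds) auto
  have g: "\<bar>g x - g y\<bar> \<le> d x y"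
    unfolding g_def using close x y s
    by (intro abs_diff_Sup_le I clamp_bounds) auto
  show "kext d I a s r x \<le> kext d I a s r y + d x y"
    using f g unfolding kext_def f_def[symmetric] g_def[symmetric] by linarith
  have "d x y - g y \<le> f x"
    unfolding f_def
  proof (rule cINF_greatest[OF I])
    fix i assume i: "i \<in> I"
    have "d y (s i) - clamp d a s r i \<le> g y"
      unfolding g_def using i clamp_bounds(2)[OF s y] by (rule cSUP_upper)
    then show "d x y - g y \<le> clamp d a s r i + d x (s i)"
      using Xd(4)[OF x sX[OF i] y] Xd(3)[OF y sX[OF i]] by simp
  qed
  then show "d x y \<le> kext d I a s r x + kext d I a s r y"
    unfolding kext_def f_def[symmetric] g_def[symmetric] by simp
qed

text \<open>On consistent data clamping changes nothing, the infimum is attained at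
  \<open>j\<close>, and no member of the supremum exceeds \<open>r j\<close>.\<close>

lemma kext_eq:
  assumes s: "s ` I \<subseteq> X" and j: "j \<in> I"
    and r: "\<And>i j. i \<in> I \<Longrightarrow> j \<in> I \<Longrightarrow> r i \<le> r j + d (s i) (s j) \<and> d (s i) (s j) \<le> r i + r j"
  shows "kext d I a s r (s j) = r j"
proof -
  have sX: "s i \<in> X" if "i \<in> I" for i using s that by blast
  have clamp: "clamp d a s r i = r i" if "i \<in> I" for i
    using r[OF that a] by (simp add: clamp_def)
  have refl: "d (s j) (s j) = 0" using pseudometric_onD(1)[OF X] sX j by blast
  have "(INF i\<in>I. clamp d a s r i + d (s j) (s i)) \<le> r j"
    using clamp[OF j] refl clamp_bounds(1)[OF s sX[OF j], of r] by (intro cINF_lower2[OF _ j]) auto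
  moreover have "r j \<le> (INF i\<in>I. clamp d a s r i + d (s j) (s i))"
    using a r[OF j] clamp by (intro cINF_greatest) (auto simp: add.commute)
  moreover have "(SUP i\<in>I. d (s j) (s i) - clamp d a s r i) \<le> r j"
    using a r[OF j] clamp by (intro cSUP_least) (auto simp: algebra_simps)
  ultimately show ?thesis by (simp add: kext_def)
qed

text \<open>The factor 4 adds up as follows: \<open>d (s i) (s a)\<close> changes by at most 2e and
  \<open>r a\<close> by e, so the clamped value by 3e; \<open>d x (s i)\<close> contributes another
  e. The bound does not depend on \<open>x\<close>.\<close>

lemma kext_close:
  assumes s: "s ` I \<subseteq> X" "s' ` I \<subseteq> X" and x: "x \<in> X"
    and e: "\<And>i. i \<in> I \<Longrightarrow> d (s i) (s' i) \<le> e" "\<And>i. i \<in> I \<Longrightarrow> \<bar>r i - r' i\<bar> \<le> e"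
  shows "\<bar>kext d I a s r x - kext d I a s' r' x\<bar> \<le> 4 * e"
proof -
  note Xd = pseudometric_onD[OF X]
  have I: "I \<noteq> {}" using a by blast
  have sX: "s i \<in> X" "s' i \<in> X" if "i \<in> I" for i using s that by blast+
  have dx: "\<bar>d x (s i) - d x (s' i)\<bar> \<le> e" if i: "i \<in> I" for i
    using Xd(4)[OF x sX(1)[OF i] sX(2)[OF i]] Xd(4)[OF x sX(2)[OF i] sX(1)[OF i]] e(1)[OF i]
      Xd(3)[OF sX(1)[OF i] sX(2)[OF i]] by simp
  have da: "\<bar>d (s i) (s a) - d (s' i) (s' a)\<bar> \<le> 2 * e" if i: "i \<in> I" for i
    using Xd(4)[OF sX(1)[OF i] sX(2)[OF i] sX(1)[OF a]] Xd(4)[OF sX(2)[OF i] sX(1)[OF i] sX(2)[OF a]]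
      Xd(4)[OF sX(2)[OF i] sX(2)[OF a] sX(1)[OF a]] Xd(4)[OF sX(1)[OF i] sX(1)[OF a] sX(2)[OF a]]
      e(1)[OF i] e(1)[OF a] Xd(3)[OF sX(1)[OF i] sX(2)[OF i]] Xd(3)[OF sX(1)[OF a] sX(2)[OF a]] by linarith
  have clamp: "\<bar>clamp d a s r i - clamp d a s' r' i\<bar> \<le> 3 * e" if i: "i \<in> I" for i
    using da[OF i] e(2)[OF i] e(2)[OF a] unfolding clamp_def max_def by (auto simp: abs_le_iff)
  have "\<bar>(INF i\<in>I. clamp d a s r i + d x (s i)) - (INF i\<in>I. clamp d a s' r' i + d x (s' i))\<bar> \<le> 4 * e"
    using clamp dx by (intro abs_diff_Inf_le I clamp_bounds s x) fastforce
  moreover have "\<bar>(SUP i\<in>I. d x (s i) - clamp d a s r i) - (SUP i\<in>I. d x (s' i) - clamp d a s' r' i)\<bar> \<le> 4 * e"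
    using clamp dx by (intro abs_diff_Sup_le I clamp_bounds s x) fastforce
  ultimately show ?thesis by (auto simp: kext_def max_def abs_le_iff)
qed

end

subsection \<open>A tower of Katetov extensions\<close>

text \<open>
  \<open>Node \<alpha> s r\<close> is the point at level \<open>\<alpha>\<close> with prescribed distances \<open>r i\<close> to the points \<open>s i\<close>,
  \<open>i \<le> \<alpha>\<close>, of lower levels.
\<close>

datatype ('x, 'k) kterm = Base 'x | Node 'k "'k \<Rightarrow> ('x, 'k) kterm" "'k \<Rightarrow> real"

locale katetov_tower = power_closed_cardinal m for m :: "'k rel" +
  fixes X :: "'x set" and d0 :: "'x \<Rightarrow> 'x \<Rightarrow> real"
  assumes d0: "pseudometric_on X d0" and X_nonempty: "X \<noteq> {}"
begin

section \<open>Terms and their levels\<close>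

fun low :: "('x, 'k) kterm \<Rightarrow> 'k \<Rightarrow> bool" where
  "low (Base x) \<alpha> \<longleftrightarrow> True"
| "low (Node \<beta> s r) \<alpha> \<longleftrightarrow> \<beta> \<sqsubset> \<alpha>"

inductive_set terms :: "('x, 'k) kterm set" where
  Base: "x \<in> X \<Longrightarrow> Base x \<in> terms"
| Node: "\<alpha> \<in> Field m \<Longrightarrow> (\<And>i. s i \<in> terms) \<Longrightarrow> (\<And>i. low (s i) \<alpha>) \<Longrightarrow> Node \<alpha> s r \<in> terms"

definition lower :: "'k \<Rightarrow> ('x, 'k) kterm set"
  where "lower \<alpha> = {t \<in> terms. low t \<alpha>}"

definition level :: "'k \<Rightarrow> ('x, 'k) kterm set"
  where "level \<alpha> = {Node \<alpha> s r | s r. Node \<alpha> s r \<in> terms}"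

lemma Node_termsD: "Node \<alpha> s r \<in> terms \<Longrightarrow> \<alpha> \<in> Field m \<and> (\<forall>i. s i \<in> lower \<alpha>)"
  by (erule terms.cases) (auto simp: lower_def)

lemma Base_terms_iff [simp]: "Base x \<in> terms \<longleftrightarrow> x \<in> X"
  by (auto intro: terms.Base elim: terms.cases)

lemma low_mono: "low t \<alpha> \<Longrightarrow> \<alpha> \<sqsubset> \<beta> \<Longrightarrow> low t \<beta>"
  by (cases t) (auto intro: below_trans)

lemma Base_lower: "x \<in> X \<Longrightarrow> Base x \<in> lower \<alpha>"
  by (simp add: lower_def)

text \<open>Base points count as lying below every level, even the least, so suprema over
  \<open>lower \<alpha>\<close> never range over the empty set.\<close>

lemma lower_nonempty: "lower \<alpha> \<noteq> {}"
  using X_nonempty Base_lower by blast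

lemma lower_level_mono: "\<beta> \<sqsubset> \<alpha> \<Longrightarrow> lower \<beta> \<union> level \<beta> \<subseteq> lower \<alpha>"
  by (auto simp: lower_def level_def intro: low_mono)

lemma small_subset_lower:
  assumes "J \<subseteq> terms" "|J| <o m"
  obtains \<alpha> where "\<alpha> \<in> Field m" "J \<subseteq> lower \<alpha>"
proof -
  \<comment> \<open>A base point has no level; any element of \<open>Field m\<close> may stand in
    for it.\<close>
  define l where "l t = (case t of Base _ \<Rightarrow> (SOME a. a \<in> Field m) | Node \<alpha> _ _ \<Rightarrow> \<alpha>)" for t :: "('x, 'k) kterm"
  have "l t \<in> Field m" if "t \<in> terms" for t
    using that infinite_Field
    by (cases rule: terms.cases) (auto simp: l_def some_in_eq)
  then have "l ` J \<subseteq> Field m" using assms(1) by blast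
  then obtain \<alpha> where "\<alpha> \<in> Field m" "\<And>t. t \<in> J \<Longrightarrow> l t \<sqsubset> \<alpha>"
    using small_bounded[OF _ card_image_less[OF assms(2), of l]] by auto
  moreover have "low t \<alpha>" if "l t \<sqsubset> \<alpha>" for t
    using that by (cases t) (auto simp: l_def)
  ultimately show thesis
    using that assms(1) unfolding lower_def by blast
qed

text \<open>
  \<open>H \<alpha> t z\<close> stands for the distance from a point \<open>t\<close> at level \<open>\<alpha>\<close> to a point \<open>z\<close> of lower level.
\<close>

definition dist_via :: "('k \<Rightarrow> ('x, 'k) kterm \<Rightarrow> ('x, 'k) kterm \<Rightarrow> real) \<Rightarrow>
    ('x, 'k) kterm \<Rightarrow> ('x, 'k) kterm \<Rightarrow> real" where
  "dist_via H x y = (case x of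
     Base a \<Rightarrow> (case y of Base b \<Rightarrow> d0 a b | Node \<beta> _ _ \<Rightarrow> H \<beta> y x)
   | Node \<alpha> _ _ \<Rightarrow> (case y of Base b \<Rightarrow> H \<alpha> x y
      | Node \<beta> _ _ \<Rightarrow> if \<alpha> \<sqsubset> \<beta> then H \<beta> y x else if \<beta> \<sqsubset> \<alpha> then H \<alpha> x y
          else (SUP z\<in>lower \<alpha>. \<bar>H \<alpha> x z - H \<alpha> y z\<bar>)))"

text \<open>The recursion is on the level alone, the term being a further argument. It is
  well-founded because \<open>kext\<close> at level \<alpha> asks only for distances between points
  of lower levels, for which \<open>dist_via\<close> consults \<open>H\<close> only below
  \<alpha>.\<close>

definition node_value :: "'k \<Rightarrow> ('x, 'k) kterm \<Rightarrow> ('x, 'k) kterm \<Rightarrow> real" where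
  "node_value = wfrec {(\<alpha>, \<beta>). \<alpha> \<sqsubset> \<beta>} (\<lambda>H \<alpha> t z.
     case t of Base _ \<Rightarrow> 0 | Node _ s r \<Rightarrow> kext (dist_via H) (segment \<alpha>) \<alpha> s r z)"

definition kdist :: "('x, 'k) kterm \<Rightarrow> ('x, 'k) kterm \<Rightarrow> real"
  where "kdist = dist_via node_value"

lemma dist_via_cut:
  assumes "low x \<alpha>" "low y \<alpha>"
  shows "dist_via (cut H {(\<alpha>, \<beta>). \<alpha> \<sqsubset> \<beta>} \<alpha>) x y = dist_via H x y"
  using assms by (auto simp: dist_via_def cut_def split: kterm.split)

lemma node_value_eq:
  assumes "Node \<alpha> s r \<in> terms" "z \<in> lower \<alpha>"
  shows "node_value \<alpha> (Node \<alpha> s r) z = kext kdist (segment \<alpha>) \<alpha> s r z"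
proof -
  have "node_value \<alpha> (Node \<alpha> s r) z =
      kext (dist_via (cut node_value {(\<alpha>, \<beta>). \<alpha> \<sqsubset> \<beta>} \<alpha>)) (segment \<alpha>) \<alpha> s r z"
    unfolding node_value_def by (subst wfrec[OF wf_below]) simp
  also have "\<dots> = kext kdist (segment \<alpha>) \<alpha> s r z"
    unfolding kdist_def using assms Node_termsD[OF assms(1)]
    by (intro kext_cong dist_via_cut) (auto simp: lower_def)
  finally show ?thesis .
qed

lemma kdist_Base [simp]: "kdist (Base x) (Base y) = d0 x y"
  by (simp add: kdist_def dist_via_def)

lemma kdist_Node_eq_value:
  assumes "low z \<alpha>"
  shows "kdist (Node \<alpha> s r) z = node_value \<alpha> (Node \<alpha> s r) z"
  using assms below_asym by (auto simp: kdist_def dist_via_def split: kterm.split)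

lemma kdist_Node_lower:
  assumes "Node \<alpha> s r \<in> terms" "z \<in> lower \<alpha>"
  shows "kdist (Node \<alpha> s r) z = kext kdist (segment \<alpha>) \<alpha> s r z"
  using assms node_value_eq kdist_Node_eq_value by (simp add: lower_def)

lemma kdist_lower_commute:
  assumes "t \<in> level \<alpha>" "z \<in> lower \<alpha>"
  shows "kdist z t = kdist t z"
  using assms by (auto simp: kdist_def dist_via_def level_def lower_def below_asym split: kterm.split)

lemma kdist_same_level:
  assumes "t \<in> level \<alpha>" "u \<in> level \<alpha>"
  shows "kdist t u = (SUP z\<in>lower \<alpha>. \<bar>kdist t z - kdist u z\<bar>)"
proof -
  obtain s r s' r' where eq: "t = Node \<alpha> s r" "u = Node \<alpha> s' r'"
    using assms by (auto simp: level_def)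
  have "kdist t u = (SUP z\<in>lower \<alpha>. \<bar>node_value \<alpha> t z - node_value \<alpha> u z\<bar>)"
    by (simp add: eq kdist_def dist_via_def)
  also have "\<dots> = (SUP z\<in>lower \<alpha>. \<bar>kdist t z - kdist u z\<bar>)"
    by (intro arg_cong[where f = Sup] image_cong refl) (simp add: eq kdist_Node_eq_value lower_def)
  finally show ?thesis .
qed

section \<open>The distance on terms is a pseudometric\<close>

lemma katetov_kdist:
  assumes "pseudometric_on (lower \<alpha>) kdist" "t \<in> level \<alpha>"
  shows "katetov_on (lower \<alpha>) kdist (kdist t)"
proof -
  obtain s r where t: "t = Node \<alpha> s r" "Node \<alpha> s r \<in> terms"
    using assms(2) by (auto simp: level_def)
  have "katetov_on (lower \<alpha>) kdist (kext kdist (segment \<alpha>) \<alpha> s r)"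
    using Node_termsD[OF t(2)] by (intro kext_katetov[OF assms(1)]) auto
  then show ?thesis
    unfolding katetov_on_def t(1) by (simp add: kdist_Node_lower[OF t(2)])
qed

lemma pseudometric_level:
  assumes "pseudometric_on (lower \<alpha>) kdist"
  shows "pseudometric_on (lower \<alpha> \<union> level \<alpha>) kdist"
  by (rule pseudometric_on_extend[OF assms lower_nonempty])
    (auto intro: katetov_kdist[OF assms] kdist_lower_commute kdist_same_level)

text \<open>A finite set of terms that are not all base points has a highest level. As this holds
  for every \<alpha>, inductions over levels need no separate limit case.\<close>

lemma finite_subset_lower:
  assumes "finite F" "F \<subseteq> lower \<alpha>"
  shows "F \<subseteq> Base ` X \<or> (\<exists>\<beta>. \<beta> \<sqsubset> \<alpha> \<and> F \<subseteq> lower \<beta> \<union> level \<beta>)"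
  using assms
proof (induction F rule: finite_induct)
  case (insert t F)
  then have t: "t \<in> terms" "low t \<alpha>" by (auto simp: lower_def)
  have mono: "lower \<beta> \<union> level \<beta> \<subseteq> lower \<gamma> \<union> level \<gamma>" if "\<beta> \<sqsubset> \<gamma> \<or> \<beta> = \<gamma>" for \<beta> \<gamma>
    using that lower_level_mono by blast
  show ?case
  proof (cases t)
    case (Base x)
    then have "x \<in> X" "\<And>\<beta>. t \<in> lower \<beta>" using t by (auto simp: lower_def)
    then show ?thesis using insert Base by blast
  next
    case (Node \<gamma> s r)
    then have \<gamma>: "t \<in> level \<gamma>" "\<gamma> \<sqsubset> \<alpha>" using t by (auto simp: level_def)
    consider "F \<subseteq> Base ` X" | \<beta> where "\<beta> \<sqsubset> \<alpha>" "F \<subseteq> lower \<beta> \<union> level \<beta>"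
      using insert by blast
    then show ?thesis
    proof cases
      case 1
      then have "F \<subseteq> lower \<gamma>" using Base_lower by blast
      then show ?thesis using \<gamma> by blast
    next
      case 2
      have "\<beta> \<sqsubset> \<gamma> \<or> \<beta> = \<gamma> \<or> \<gamma> \<sqsubset> \<beta>"
        using below_total below_Field 2(1) \<gamma>(2) by blast
      then have "insert t F \<subseteq> lower \<gamma> \<union> level \<gamma> \<or> insert t F \<subseteq> lower \<beta> \<union> level \<beta>"
        using mono[of \<beta> \<gamma>] mono[of \<gamma> \<beta>] 2(2) \<gamma>(1) by blast
      then show ?thesis using 2(1) \<gamma>(2) by blast
    qed
  qed
qed simp

lemma pseudometric_Base: "pseudometric_on (Base ` X) kdist"
  using d0 by (simp add: pseudometric_on_def)

lemma pseudometric_lower: "pseudometric_on (lower \<alpha>) kdist"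
proof (induction \<alpha> rule: wf_induct_rule[OF wf_below])
  case (1 \<alpha>)
  then have *: "pseudometric_on (lower \<beta> \<union> level \<beta>) kdist" if "\<beta> \<sqsubset> \<alpha>" for \<beta>
    using pseudometric_level that by simp
  then show ?case
  proof (intro pseudometric_on_finite_character)
    fix F assume "finite F" "F \<subseteq> lower \<alpha>"
    then consider "F \<subseteq> Base ` X" | \<beta> where "\<beta> \<sqsubset> \<alpha>" "F \<subseteq> lower \<beta> \<union> level \<beta>"
      using finite_subset_lower by metis
    then show "\<exists>Y. F \<subseteq> Y \<and> pseudometric_on Y kdist"
      using pseudometric_Base * by cases blast+
  qed
qed

lemma pseudometric_kdist: "pseudometric_on terms kdist"
proof (rule pseudometric_on_finite_character)
  fix F assume "finite F" "F \<subseteq> terms"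
  then obtain \<alpha> where "F \<subseteq> lower \<alpha>"
    using small_subset_lower[of F] finite_card_less[of F] by blast
  then show "\<exists>Y. F \<subseteq> Y \<and> pseudometric_on Y kdist"
    using pseudometric_lower by blast
qed

lemmas kdist_rules = pseudometric_onD[OF pseudometric_kdist]

text \<open>Nodes of one level are compared by a uniform distance, so the bound of
  \<open>kext_close\<close> passes to the supremum. Later inductions on terms ask for
  \<open>e / 8\<close> at the children, which leaves \<open>e / 2\<close> at the node.\<close>

lemma kdist_Node_close:
  assumes t: "Node \<alpha> s r \<in> terms" "Node \<alpha> s' r' \<in> terms"
    and e: "\<And>i. i \<in> segment \<alpha> \<Longrightarrow> kdist (s i) (s' i) \<le> e" "\<And>i. i \<in> segment \<alpha> \<Longrightarrow> \<bar>r i - r' i\<bar> \<le> e"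
  shows "kdist (Node \<alpha> s r) (Node \<alpha> s' r') \<le> 4 * e"
proof -
  have l: "Node \<alpha> s r \<in> level \<alpha>" "Node \<alpha> s' r' \<in> level \<alpha>"
    using t by (auto simp: level_def)
  have "\<bar>kdist (Node \<alpha> s r) z - kdist (Node \<alpha> s' r') z\<bar> \<le> 4 * e" if "z \<in> lower \<alpha>" for z
    unfolding kdist_Node_lower[OF t(1) that] kdist_Node_lower[OF t(2) that]
    using Node_termsD[OF t(1)] Node_termsD[OF t(2)] e that
    by (intro kext_close[OF pseudometric_lower]) auto
  then show ?thesis
    unfolding kdist_same_level[OF l] using lower_nonempty by (intro cSUP_least) auto
qed

text \<open>By regularity all \<open>a j\<close> lie below a single level whose segment can index
  \<open>J\<close>, and the node with data \<open>r\<close> at that level has exactly the required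
  distances because \<open>kext\<close> is exact on consistent data. The index type is free, so that
  the back-and-forth argument can use a relation itself as \<open>J\<close>.\<close>

lemma extension_property:
  assumes J: "|J| <o m" and a: "a ` J \<subseteq> terms"
    and r: "\<And>i j. i \<in> J \<Longrightarrow> j \<in> J \<Longrightarrow> r i \<le> r j + kdist (a i) (a j) \<and> kdist (a i) (a j) \<le> r i + r j"
  shows "\<exists>y\<in>terms. \<forall>j\<in>J. kdist y (a j) = r j"
proof (cases "J = {}")
  case True
  obtain x where "x \<in> X" using X_nonempty by blast
  then show ?thesis using True by (intro bexI[of _ "Base x"]) auto
next
  case False
  define l where "l j = (SOME \<alpha>. \<alpha> \<in> Field m \<and> a j \<in> lower \<alpha>)" for j
  have l: "l j \<in> Field m \<and> a j \<in> lower (l j)" if j: "j \<in> J" for j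
  proof -
    obtain \<alpha> where "\<alpha> \<in> Field m \<and> a j \<in> lower \<alpha>"
      by (rule small_subset_lower[of "{a j}"]) (use a j finite_card_less[of "{a j}"] in auto)
    then show ?thesis unfolding l_def by (rule someI)
  qed
  then have "l ` J \<subseteq> Field m" by blast
  then obtain \<alpha> e where \<alpha>: "\<alpha> \<in> Field m" "e ` segment \<alpha> = J" "\<And>j. j \<in> J \<Longrightarrow> l j \<sqsubset> \<alpha>"
    using small_segment_surj[OF J False] by metis
  obtain x where x: "x \<in> X" using X_nonempty by blast
  \<comment> \<open>Outside the segment any point of lower level will do, since \<open>kext\<close>
    consults only indices in the segment.\<close>
  define s where "s i = (if i \<in> segment \<alpha> then a (e i) else Base x)" for i
  define r' where "r' i = r (e i)" for i
  have a_low: "a j \<in> lower \<alpha>" if "j \<in> J" for j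
    using l[OF that] \<alpha>(3)[OF that] low_mono by (auto simp: lower_def)
  have s: "s i \<in> lower \<alpha>" for i
    using a_low \<alpha>(2) Base_lower[OF x] by (auto simp: s_def)
  have y: "Node \<alpha> s r' \<in> terms"
    using \<alpha>(1) s by (intro terms.Node) (auto simp: lower_def)
  have "kdist (Node \<alpha> s r') (a j) = r j" if j: "j \<in> J" for j
  proof -
    obtain i where i: "i \<in> segment \<alpha>" "j = e i" using \<alpha>(2) j by blast
    have "kdist (Node \<alpha> s r') (s i) = kext kdist (segment \<alpha>) \<alpha> s r' (s i)"
      using y s by (rule kdist_Node_lower)
    also have "\<dots> = r' i"
      using s i r \<alpha>(2)
      by (intro kext_eq[OF pseudometric_lower[of \<alpha>]]) (auto simp: s_def r'_def a_low)
    finally show ?thesis using i by (simp add: s_def r'_def)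
  qed
  then show ?thesis using y by blast
qed

section \<open>Naturality of the tower under isometries of its base\<close>

lemma map_kterm_terms:
  assumes "\<sigma> ` X \<subseteq> X" "t \<in> terms"
  shows "map_kterm \<sigma> t \<in> terms \<and> (\<forall>\<alpha>. low (map_kterm \<sigma> t) \<alpha> \<longleftrightarrow> low t \<alpha>)"
  using assms(2)
proof (induction rule: terms.induct)
  case (Node \<alpha> s r)
  then show ?case by (auto intro!: terms.Node)
qed (use assms(1) in auto)

lemma map_kterm_cancel:
  assumes "\<And>x. x \<in> X \<Longrightarrow> \<tau> (\<sigma> x) = x" "t \<in> terms"
  shows "map_kterm \<tau> (map_kterm \<sigma> t) = t"
  using assms(2) by (induction rule: terms.induct) (auto simp: assms(1) fun_eq_iff)

text \<open>Distances from a node to lower points are preserved by \<open>kext_cong\<close>. For two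
  nodes of equal level the supremum ranges over \<open>lower \<alpha>\<close>, which the induced map
  must therefore cover; the right inverse \<tau> provides the preimages.\<close>

lemma kdist_map_kterm:
  assumes \<sigma>: "\<sigma> ` X \<subseteq> X" "\<tau> ` X \<subseteq> X" "\<And>x. x \<in> X \<Longrightarrow> \<sigma> (\<tau> x) = x"
    and iso: "\<And>x y. x \<in> X \<Longrightarrow> y \<in> X \<Longrightarrow> d0 (\<sigma> x) (\<sigma> y) = d0 x y"
    and xy: "x \<in> terms" "y \<in> terms"
  shows "kdist (map_kterm \<sigma> x) (map_kterm \<sigma> y) = kdist x y"
proof -
  let ?A = "map_kterm \<sigma> :: ('x, 'k) kterm \<Rightarrow> ('x, 'k) kterm"
  have A_lower: "?A t \<in> lower \<alpha>" if "t \<in> lower \<alpha>" for t \<alpha>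
    using map_kterm_terms[OF \<sigma>(1)] that by (simp add: lower_def)
  have A_image: "?A ` lower \<alpha> = lower \<alpha>" for \<alpha>
  proof
    show "lower \<alpha> \<subseteq> ?A ` lower \<alpha>"
    proof
      fix t assume t: "t \<in> lower \<alpha>"
      then have "map_kterm \<tau> t \<in> lower \<alpha>"
        using map_kterm_terms[OF \<sigma>(2)] by (simp add: lower_def)
      moreover have "?A (map_kterm \<tau> t) = t"
        using map_kterm_cancel[of \<sigma> \<tau> t] \<sigma>(3) t by (simp add: lower_def)
      ultimately show "t \<in> ?A ` lower \<alpha>" by (metis imageI)
    qed
  qed (use A_lower in blast)
  have A_level: "?A t \<in> level \<alpha>" if "t \<in> level \<alpha>" for t \<alpha>
    using that map_kterm_terms[OF \<sigma>(1), of t] by (auto simp: level_def)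
  have step: "kdist (?A x) (?A y) = kdist x y"
    if IH: "\<And>x y. x \<in> lower \<alpha> \<Longrightarrow> y \<in> lower \<alpha> \<Longrightarrow> kdist (?A x) (?A y) = kdist x y"
      and xy: "x \<in> lower \<alpha> \<union> level \<alpha>" "y \<in> lower \<alpha> \<union> level \<alpha>" for \<alpha> x y
  proof -
    have node: "kdist (?A t) (?A z) = kdist t z" if t: "t \<in> level \<alpha>" and z: "z \<in> lower \<alpha>" for t z
    proof -
      obtain s r where eq: "t = Node \<alpha> s r" and st: "Node \<alpha> s r \<in> terms"
        using t by (auto simp: level_def)
      have s: "s i \<in> lower \<alpha>" for i using Node_termsD[OF st] by blast
      have At: "Node \<alpha> (map_kterm \<sigma> \<circ> s) r \<in> terms"
        using A_level[OF t] by (auto simp: eq level_def)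
      have "kdist (?A t) (?A z) = kext kdist (segment \<alpha>) \<alpha> (map_kterm \<sigma> \<circ> s) r (?A z)"
        using kdist_Node_lower[OF At A_lower[OF z]] by (simp add: eq)
      also have "\<dots> = kext kdist (segment \<alpha>) \<alpha> s r z"
        using s z by (intro kext_cong) (auto simp: IH)
      also have "\<dots> = kdist t z"
        using kdist_Node_lower[OF st z] by (simp add: eq)
      finally show ?thesis .
    qed
    consider "x \<in> lower \<alpha>" "y \<in> lower \<alpha>" | "x \<in> level \<alpha>" "y \<in> lower \<alpha>" | "x \<in> lower \<alpha>" "y \<in> level \<alpha>"
      | "x \<in> level \<alpha>" "y \<in> level \<alpha>"
      using xy by blast
    then show ?thesis
    proof cases
      case 1 then show ?thesis by (rule IH)
    next
      case 2 then show ?thesis by (rule node)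
    next
      case 3
      then show ?thesis
        using node kdist_lower_commute A_level A_lower by metis
    next
      case 4
      have "kdist (?A x) (?A y) = (SUP z\<in>?A ` lower \<alpha>. \<bar>kdist (?A x) z - kdist (?A y) z\<bar>)"
        using kdist_same_level[OF A_level[OF 4(1)] A_level[OF 4(2)]] by (simp add: A_image)
      also have "\<dots> = (SUP z\<in>lower \<alpha>. \<bar>kdist x z - kdist y z\<bar>)"
        using node 4 by (simp add: image_image)
      also have "\<dots> = kdist x y"
        using kdist_same_level[OF 4] by simp
      finally show ?thesis .
    qed
  qed
  have all: "\<forall>x\<in>lower \<alpha>. \<forall>y\<in>lower \<alpha>. kdist (?A x) (?A y) = kdist x y" for \<alpha>
  proof (induction \<alpha> rule: wf_induct_rule[OF wf_below])
    case (1 \<alpha>)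
    show ?case
    proof (intro ballI)
      fix x y assume xy: "x \<in> lower \<alpha>" "y \<in> lower \<alpha>"
      consider "{x, y} \<subseteq> Base ` X" | \<beta> where "\<beta> \<sqsubset> \<alpha>" "{x, y} \<subseteq> lower \<beta> \<union> level \<beta>"
        using finite_subset_lower[of "{x, y}" \<alpha>] xy by auto
      then show "kdist (?A x) (?A y) = kdist x y"
      proof cases
        case 1 then show ?thesis using iso by auto
      next
        case (2 \<beta>)
        then show ?thesis using 1 step[of \<beta> x y] by auto
      qed
    qed
  qed
  obtain \<alpha> where "{x, y} \<subseteq> lower \<alpha>"
    using small_subset_lower[of "{x, y}"] finite_card_less[of "{x, y}"] xy by auto
  then show ?thesis using all by blast
qed

section \<open>A dense set of at most m terms\<close>

context
  fixes X0 :: "'x set" and x0 :: 'x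
  assumes X0: "X0 \<subseteq> X" "|X0| \<le>o m" "\<And>x e. x \<in> X \<Longrightarrow> 0 < e \<Longrightarrow> \<exists>x'\<in>X0. d0 x x' < e"
    and x0: "x0 \<in> X0"
begin

text \<open>Data outside the segment are pinned to fixed values, so that a rational node is
  determined by a function on a set of size below m.\<close>

inductive_set rational_terms :: "('x, 'k) kterm set" where
  rational_Base: "x \<in> X0 \<Longrightarrow> Base x \<in> rational_terms"
| rational_Node: "\<alpha> \<in> Field m \<Longrightarrow> (\<And>i. s i \<in> rational_terms) \<Longrightarrow> (\<And>i. low (s i) \<alpha>) \<Longrightarrow>
    (\<And>i. r i \<in> \<rat>) \<Longrightarrow> (\<And>i. i \<notin> segment \<alpha> \<Longrightarrow> s i = Base x0 \<and> r i = 0) \<Longrightarrow> Node \<alpha> s r \<in> rational_terms"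

lemma rational_terms_subset: "rational_terms \<subseteq> terms"
proof
  fix t assume "t \<in> rational_terms"
  then show "t \<in> terms"
    by (induction rule: rational_terms.induct) (use X0 in \<open>auto intro: terms.Node\<close>)
qed

text \<open>Preservation of levels is part of the induction: it allows the approximating children to
  be joined by a node of the original level.\<close>

lemma rational_terms_dense:
  assumes "t \<in> terms" "0 < e"
  shows "\<exists>t'\<in>rational_terms. kdist t t' < e \<and> (\<forall>\<alpha>. low t' \<alpha> \<longleftrightarrow> low t \<alpha>)"
  using assms
proof (induction arbitrary: e rule: terms.induct)
  case (Base x)
  then obtain x' where "x' \<in> X0" "d0 x x' < e" using X0(3) by blast
  then show ?case by (intro bexI[of _ "Base x'"]) (auto intro: rational_Base)
next
  case (Node \<alpha> s r)
  have "\<exists>t'\<in>rational_terms. kdist (s i) t' < e / 8 \<and> (\<forall>\<alpha>. low t' \<alpha> \<longleftrightarrow> low (s i) \<alpha>)" for i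
    using Node.IH[of "e / 8" i] Node.prems by simp
  then obtain s' where s': "\<And>i. s' i \<in> rational_terms" "\<And>i. kdist (s i) (s' i) < e / 8"
    "\<And>i \<alpha>. low (s' i) \<alpha> \<longleftrightarrow> low (s i) \<alpha>"
    by metis
  have "\<exists>q\<in>\<rat>. \<bar>r i - q\<bar> < e / 8" for i
    using Rats_dense_in_real[of "r i" "r i + e / 8"] Node.prems by (auto intro!: bexI)
  then obtain r' where r': "\<And>i. r' i \<in> \<rat>" "\<And>i. \<bar>r i - r' i\<bar> < e / 8"
    by metis
  define s'' where "s'' i = (if i \<in> segment \<alpha> then s' i else Base x0)" for i
  define r'' where "r'' i = (if i \<in> segment \<alpha> then r' i else 0)" for i
  have mem: "Node \<alpha> s'' r'' \<in> rational_terms"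
    using s' r' Node.hyps x0 by (intro rational_Node) (auto simp: s''_def r''_def intro: rational_Base)
  have "kdist (Node \<alpha> s r) (Node \<alpha> s'' r'') \<le> 4 * (e / 8)"
  proof (rule kdist_Node_close)
    show "Node \<alpha> s r \<in> terms" using Node.hyps by (intro terms.Node) auto
    show "Node \<alpha> s'' r'' \<in> terms" using mem rational_terms_subset by blast
  qed (use s' r' in \<open>auto simp: s''_def r''_def intro: less_imp_le\<close>)
  then show ?case using mem Node.prems by (intro bexI[OF _ mem]) auto
qed

text \<open>Nodes of level \<alpha> are images of functions from the segment of \<alpha> to pairs of
  a lower rational term and a rational number. By induction there are at most m such pairs, hence by
  \<open>card_Func_le\<close> at most m nodes on each of the m levels.\<close>

lemma card_rational_terms: "|rational_terms| \<le>o m"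
proof -
  define L where "L \<alpha> = {Node \<alpha> s r | s r. Node \<alpha> s r \<in> rational_terms}" for \<alpha>
  have cases: "t \<in> Base ` X0 \<or> (\<exists>\<beta>\<in>Field m. t \<in> L \<beta>)" if "t \<in> rational_terms" for t
    using that by (cases rule: rational_terms.cases) (auto simp: L_def intro: rational_Node)
  have L: "|L \<alpha>| \<le>o m" if "\<alpha> \<in> Field m" for \<alpha>
    using that
  proof (induction \<alpha> rule: wf_induct_rule[OF wf_below])
    case (1 \<alpha>)
    let ?B = "{t \<in> rational_terms. low t \<alpha>}"
    have "?B \<subseteq> Base ` X0 \<union> (\<Union>\<beta>\<in>{\<beta>. \<beta> \<sqsubset> \<alpha>}. L \<beta>)"
      using cases by (fastforce simp: L_def)
    moreover have "|\<Union>\<beta>\<in>{\<beta>. \<beta> \<sqsubset> \<alpha>}. L \<beta>| \<le>o m"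
      using 1 below_Field by (intro card_UN_le card_le_mI) auto
    moreover have "|Base ` X0 :: ('x, 'k) kterm set| \<le>o m"
      using X0(2) by (rule card_image_le)
    ultimately have B: "|?B| \<le>o m"
      using card_Un_le card_subset_le by blast
    define \<Phi> where "\<Phi> \<phi> = Node \<alpha> (\<lambda>i. if i \<in> segment \<alpha> then fst (\<phi> i) else Base x0)
      (\<lambda>i. if i \<in> segment \<alpha> then snd (\<phi> i) else 0)" for \<phi> :: "'k \<Rightarrow> ('x, 'k) kterm \<times> real"
    have "|Func (segment \<alpha>) (?B \<times> \<rat>)| \<le>o m"
      using B 1(2)
      by (intro card_Func_le card_segment segment_Field card_Times_le countable_card_le[OF countable_rat])
    moreover have "L \<alpha> \<subseteq> \<Phi> ` Func (segment \<alpha>) (?B \<times> \<rat>)"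
    proof
      fix t assume "t \<in> L \<alpha>"
      then obtain s r where t: "t = Node \<alpha> s r" "Node \<alpha> s r \<in> rational_terms"
        by (auto simp: L_def)
      from t(2) have sr: "\<And>i. s i \<in> ?B" "\<And>i. r i \<in> \<rat>" "\<And>i. i \<notin> segment \<alpha> \<Longrightarrow> s i = Base x0 \<and> r i = 0"
        by (cases rule: rational_terms.cases; auto)+
      let ?\<phi> = "\<lambda>i. if i \<in> segment \<alpha> then (s i, r i) else undefined"
      have "?\<phi> \<in> Func (segment \<alpha>) (?B \<times> \<rat>)" using sr by (auto simp: Func_def)
      moreover have "t = \<Phi> ?\<phi>" using sr by (auto simp: t(1) \<Phi>_def)
      ultimately show "t \<in> \<Phi> ` Func (segment \<alpha>) (?B \<times> \<rat>)" by blast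
    qed
    ultimately show ?case
      using card_image_le card_subset_le by blast
  qed
  have "rational_terms \<subseteq> Base ` X0 \<union> (\<Union>\<beta>\<in>Field m. L \<beta>)"
    using cases by blast
  moreover have "|Base ` X0 \<union> (\<Union>\<beta>\<in>Field m. L \<beta>)| \<le>o m"
    using L X0(2) by (intro card_Un_le card_UN_le card_image_le card_le_mI) auto
  ultimately show ?thesis by (rule card_subset_le)
qed

end

end

subsection \<open>Extension property of the Urysohn--Katetov space\<close>

lemma density_le_card:
  assumes "dense_in_topology X D"
  shows "density X \<le>o |D|"
  using density_attained[of X] assms by metis

lemma dense_set_of_base:
  assumes "base_of_topology X \<B>"
  shows "\<exists>D\<subseteq>topspace X. |D| \<le>o |\<B>| \<and> (\<forall>V. openin X V \<and> V \<noteq> {} \<longrightarrow> D \<inter> V \<noteq> {})"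
proof (intro exI conjI allI impI)
  let ?D = "(\<lambda>B. SOME x. x \<in> B) ` {B \<in> \<B>. B \<noteq> {}}"
  show "?D \<subseteq> topspace X"
  proof
    fix x assume "x \<in> ?D"
    then obtain B where "B \<in> \<B>" "B \<noteq> {}" "x = (SOME x. x \<in> B)" by blast
    then have "B \<in> \<B>" "x \<in> B" by (simp_all add: some_in_eq)
    then show "x \<in> topspace X"
      using assms openin_subset[of X B] unfolding base_of_topology_def by blast
  qed
  show "|?D| \<le>o |\<B>|"
    by (rule ordLeq_transitive[OF card_of_image card_of_mono1]) blast
  fix V assume V: "openin X V \<and> V \<noteq> {}"
  show "?D \<inter> V \<noteq> {}"
  proof -
    obtain x where x: "x \<in> V" using V by blast
    then obtain B where "B \<in> \<B>" "x \<in> B" "B \<subseteq> V"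
      using assms V unfolding base_of_topology_def by meson
    then have "(SOME x. x \<in> B) \<in> ?D \<inter> V"
      using someI[of "\<lambda>y. y \<in> B" x] by blast
    then show ?thesis by blast
  qed
qed

context power_closed_cardinal
begin

lemma weight_le_of_small:
  assumes "|mspace M| <o m"
  shows "weight (mtopology_of M) \<le>o m"
proof -
  interpret M: Metric_space "mspace M" "mdist M" by (rule Metric_space_mspace_mdist)
  let ?\<B> = "(\<lambda>(x, n). M.mball x (inverse (real (Suc n)))) ` (mspace M \<times> UNIV)"
  have "base_of_topology (mtopology_of M) ?\<B>"
    unfolding base_of_topology_def mtopology_of_def
  proof (intro conjI ballI allI impI)
    fix V x assume V: "openin M.mtopology V \<and> x \<in> V"
    then obtain e where e: "0 < e" "M.mball x e \<subseteq> V" and x: "x \<in> mspace M"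
      unfolding M.openin_mtopology by blast
    obtain n where n: "inverse (real (Suc n)) < e" using reals_Archimedean[OF e(1)] by blast
    have "M.mball x (inverse (real (Suc n))) \<subseteq> V"
      using M.mball_subset_concentric[of "inverse (real (Suc n))" e x] n e(2) by auto
    then show "\<exists>B\<in>?\<B>. x \<in> B \<and> B \<subseteq> V"
      using x by (intro bexI[of _ "M.mball x (inverse (real (Suc n)))"]) auto
  qed auto
  moreover have "|?\<B>| \<le>o m"
    by (intro card_image_le card_Times_le countable_card_le ordLess_imp_ordLeq[OF assms]) auto
  ultimately show ?thesis
    using weight_le_card_of_base ordLeq_transitive by blast
qed

lemma density_less_of_small:
  assumes "A \<subseteq> mspace U" "|A| <o m"
  shows "density (mtopology_of (submetric U A)) <o m"
proof -
  have "dense_in_topology (mtopology_of (submetric U A)) A"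
    using assms(1) closure_of_topspace[of "mtopology_of (submetric U A)"]
    by (auto simp: dense_in_topology_def Int_absorb2)
  from density_le_card[OF this] show ?thesis
    using assms(2) by (rule ordLeq_ordLess_trans)
qed

text \<open>Adjoin to \<open>B\<close> a point \<open>None\<close> at distances \<open>f\<close>.
  Universality embeds the enlarged space by some \<open>h\<close>, which may move \<open>B\<close>;
  homogeneity gives an isometry \<open>g\<close> of \<open>U\<close> that agrees with this motion on
  \<open>B\<close>, and the preimage of \<open>h None\<close> under \<open>g\<close> realizes
  \<open>f\<close>.\<close>

lemma realize_katetov:
  assumes univ: "universal_metric m U" and hom: "homogeneous_metric m U"
    and B: "B \<subseteq> mspace U" "|B| <o m" and f: "katetov_on B (mdist U) f"
  shows "\<exists>v\<in>mspace U. \<forall>b\<in>B. mdist U v b = f b"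
proof (cases "\<exists>b\<in>B. f b = 0")
  \<comment> \<open>Here the one-point extension would not be a metric space, but a zero of
    \<open>f\<close> is itself the point sought.\<close>
  case True
  then obtain b where b: "b \<in> B" "f b = 0" by blast
  have "mdist U b c = f c" if "c \<in> B" for c
    using katetov_onD[OF f b(1) that] katetov_onD[OF f that b(1)] b(2) mdist_commute[of U b c] by simp
  then show ?thesis using b B by blast
next
  case False
  interpret U: Metric_space "mspace U" "mdist U" by (rule Metric_space_mspace_mdist)
  have nonneg: "0 \<le> f b" if "b \<in> B" for b
    using katetov_onD(2)[OF f that that] U.nonneg[of b b] by linarith
  have pos: "0 < f b" if "b \<in> B" for b
    using nonneg[OF that] False that by force
  define C where "C = insert None (Some ` B)"
  \<comment> \<open>The value 0 outside \<open>C\<close> is harmless for nonnegativity and symmetry,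
    which \<open>Metric_space\<close> demands of all arguments.\<close>
  define \<delta> where "\<delta> x y = (if x \<in> C \<and> y \<in> C then
      (case x of None \<Rightarrow> (case y of None \<Rightarrow> 0 | Some b \<Rightarrow> f b)
       | Some a \<Rightarrow> (case y of None \<Rightarrow> f a | Some b \<Rightarrow> mdist U a b)) else 0)" for x y
  have tri: "f a \<le> f b + mdist U a b" "mdist U a b \<le> f a + f b" if "a \<in> B" "b \<in> B" for a b
    using katetov_onD[OF f that] by auto
  then have tri': "f a \<le> mdist U a b + f b" "f a \<le> f b + mdist U b a" if "a \<in> B" "b \<in> B" for a b
    using that mdist_commute[of U a b] by (metis add.commute)+
  have BU: "b \<in> mspace U" if "b \<in> B" for b using B(1) that by blast
  have C: "None \<in> C" "Some b \<in> C \<longleftrightarrow> b \<in> B" for b by (auto simp: C_def)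
  have \<delta>: "\<delta> None None = 0" "b \<in> B \<Longrightarrow> \<delta> None (Some b) = f b" "b \<in> B \<Longrightarrow> \<delta> (Some b) None = f b"
    "a \<in> B \<Longrightarrow> b \<in> B \<Longrightarrow> \<delta> (Some a) (Some b) = mdist U a b" for a b
    by (simp_all add: \<delta>_def C)
  have C_cases: "x = None \<or> (\<exists>b\<in>B. x = Some b)" if "x \<in> C" for x
    using that by (auto simp: C_def)
  interpret N: Metric_space C \<delta>
  proof
    fix x y
    show "0 \<le> \<delta> x y"
      using nonneg by (auto simp: \<delta>_def C split: option.split)
    show "\<delta> x y = \<delta> y x"
      by (auto simp: \<delta>_def mdist_commute split: option.split)
    show "\<delta> x y = 0 \<longleftrightarrow> x = y" if "x \<in> C" "y \<in> C"
      using C_cases[OF that(1)] C_cases[OF that(2)]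
      by (elim disjE bexE; hypsubst) (use pos in \<open>force simp: \<delta> BU\<close>)+
    fix z assume xyz: "x \<in> C" "y \<in> C" "z \<in> C"
    show "\<delta> x z \<le> \<delta> x y + \<delta> y z"
      using C_cases[OF xyz(1)] C_cases[OF xyz(2)] C_cases[OF xyz(3)]
      by (elim disjE bexE; hypsubst; simp add: \<delta> BU tri tri' nonneg U.triangle)
  qed
  define M where "M = metric (C, \<delta>)"
  have M: "mspace M = C" "mdist M = \<delta>" by (simp_all add: M_def)
  have "|{None} \<union> Some ` B| <o m"
    by (intro card_Un_less card_image_less[OF B(2)]) (simp add: finite_card_less)
  then have "weight (mtopology_of M) \<le>o m"
    by (intro weight_le_of_small) (simp add: M C_def)
  then obtain h where h: "isometric_embedding M U h"
    using universal_metric_embedding[OF univ Cinfinite] by blast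
  then have h_mem: "h x \<in> mspace U" and h_dist: "mdist U (h x) (h y) = \<delta> x y" if "x \<in> C" "y \<in> C" for x y
    using that by (auto simp: isometric_embedding_def M)
  let ?k = "\<lambda>b. h (Some b)"
  have k: "?k ` B \<subseteq> mspace U" using h_mem by (auto simp: C_def)
  have "isometry (submetric U B) (submetric U (?k ` B)) ?k"
    unfolding isometry_def isometric_embedding_def
    using B(1) k h_dist by (auto simp: C_def \<delta>_def)
  moreover have "density (mtopology_of (submetric U B)) <o m"
    "density (mtopology_of (submetric U (?k ` B))) <o m"
    using B k by (auto intro: density_less_of_small card_image_less)
  ultimately have "\<exists>g\<in>carrier (Iso U). \<forall>b\<in>B. g b = ?k b"
    using hom[unfolded homogeneous_metric_def, rule_format, of B "?k ` B" ?k] B(1) k by blast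
  then obtain g where g: "g \<in> carrier (Iso U)" "\<And>b. b \<in> B \<Longrightarrow> g b = ?k b"
    by blast
  then have iso: "isometry U U g" by (auto simp: Iso_def)
  have "h None \<in> mspace U" using h_mem[of None None] by (simp add: C_def)
  then obtain v where v: "v \<in> mspace U" "g v = h None"
    using iso unfolding isometry_def by (metis imageE)
  have "mdist U v b = f b" if "b \<in> B" for b
  proof -
    have "mdist U v b = mdist U (g v) (g b)"
      using iso v B that unfolding isometry_def isometric_embedding_def by (metis subsetD)
    also have "\<dots> = f b"
      using that v g(2) h_dist[of None "Some b"] by (simp add: C_def \<delta>_def)
    finally show ?thesis .
  qed
  then show ?thesis using v by blast
qed

end

subsection \<open>Back and forth\<close>

text \<open>A relation takes the place of a partial isometry because \<open>d\<close> will only be a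
  pseudometric: several terms may correspond to one point of \<open>U\<close>, so there need be no
  inverse map for the backward step.\<close>

definition coherent :: "'p set \<Rightarrow> ('p \<Rightarrow> 'p \<Rightarrow> real) \<Rightarrow> 'u metric \<Rightarrow> ('p \<times> 'u) set \<Rightarrow> bool" where
  "coherent P d U R \<longleftrightarrow> R \<subseteq> P \<times> mspace U \<and>
     (\<forall>(a, b)\<in>R. \<forall>(a', b')\<in>R. d a a' = mdist U b b')"

lemma coherentD:
  assumes "coherent P d U R" "(a, b) \<in> R"
  shows "a \<in> P" "b \<in> mspace U" "(a', b') \<in> R \<Longrightarrow> d a a' = mdist U b b'"
  using assms unfolding coherent_def by fast+

lemma coherent_insert:
  assumes "pseudometric_on P d" "coherent P d U R" "y \<in> P" "v \<in> mspace U"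
    and "\<And>a b. (a, b) \<in> R \<Longrightarrow> d y a = mdist U v b"
  shows "coherent P d U (insert (y, v) R)"
proof -
  have "d y y = mdist U v v"
    using pseudometric_onD(1)[OF assms(1,3,3)] assms(4) by simp
  moreover have "d a y = mdist U b v" if "(a, b) \<in> R" for a b
    using assms(5)[OF that] pseudometric_onD(3)[OF assms(1,3)] coherentD(1)[OF assms(2) that]
      mdist_commute by metis
  ultimately show ?thesis
    using assms unfolding coherent_def by auto
qed

lemma coherent_directed_UN:
  assumes "\<And>i j. i \<in> I \<Longrightarrow> j \<in> I \<Longrightarrow> \<exists>k\<in>I. R i \<subseteq> R k \<and> R j \<subseteq> R k"
    and "\<And>i. i \<in> I \<Longrightarrow> coherent P d U (R i)"
  shows "coherent P d U (\<Union>i\<in>I. R i)"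
proof -
  have "d a a' = mdist U b b'"
    if "i \<in> I" "(a, b) \<in> R i" "j \<in> I" "(a', b') \<in> R j" for a b a' b' i j
  proof -
    obtain k where "k \<in> I" "R i \<subseteq> R k" "R j \<subseteq> R k" using assms(1) \<open>i \<in> I\<close> \<open>j \<in> I\<close> by blast
    then show ?thesis using coherentD(3)[OF assms(2)] that by blast
  qed
  moreover have "R i \<subseteq> P \<times> mspace U" if "i \<in> I" for i
    using assms(2)[OF that] by (simp add: coherent_def)
  ultimately show ?thesis unfolding coherent_def by blast
qed

context power_closed_cardinal
begin

text \<open>Both dense sets are enumerated, with repetitions, along m. Fewer than m pairs have been
  chosen before any stage, so \<open>forward\<close> and \<open>backward\<close> apply there; unions
  stay coherent since coherence concerns two pairs at a time and the stages form a chain.\<close>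

lemma back_and_forth:
  fixes P :: "'p set" and U :: "'u metric"
  assumes forward: "\<And>R y. coherent P d U R \<Longrightarrow> |R| <o m \<Longrightarrow> y \<in> P \<Longrightarrow> \<exists>v. coherent P d U (insert (y, v) R)"
    and backward: "\<And>R v. coherent P d U R \<Longrightarrow> |R| <o m \<Longrightarrow> v \<in> mspace U \<Longrightarrow> \<exists>y. coherent P d U (insert (y, v) R)"
    and D: "D \<subseteq> P" "|D| \<le>o m" "D \<noteq> {}" and E: "E \<subseteq> mspace U" "|E| \<le>o m" "E \<noteq> {}"
  obtains R where "coherent P d U R" "D \<subseteq> fst ` R" "E \<subseteq> snd ` R"
proof -
  obtain p where p: "p ` Field m = D"
    using card_of_ordLeq2[OF D(3), of "Field m"] ordLeq_ordIso_trans[OF D(2) ordIso_symmetric[OF card_Field]]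
    by blast
  obtain q where q: "q ` Field m = E"
    using card_of_ordLeq2[OF E(3), of "Field m"] ordLeq_ordIso_trans[OF E(2) ordIso_symmetric[OF card_Field]]
    by blast
  \<comment> \<open>The choice \<open>r\<close> made at a stage consists of the partner of
    \<open>p \<beta>\<close> in \<open>U\<close> and the partner of \<open>q \<beta>\<close> in
    \<open>P\<close>.\<close>
  define new where "new \<beta> r = {(p \<beta>, fst r), (snd r, q \<beta>)}" for \<beta> and r :: "'u \<times> 'p"
  define old where "old f \<alpha> = (\<Union>\<beta>\<in>{\<beta>. \<beta> \<sqsubset> \<alpha>}. new \<beta> (f \<beta>))" for f \<alpha>
  \<comment> \<open>The recursion runs over the whole type, so nothing is asked outside
    \<open>Field m\<close>. The condition looks at \<open>f\<close> only below \<alpha>, as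
    dependent choice requires.\<close>
  define Good where "Good f \<alpha> r \<longleftrightarrow> (\<alpha> \<in> Field m \<longrightarrow> coherent P d U (old f \<alpha> \<union> new \<alpha> r))" for f \<alpha> r
  have "\<exists>f. \<forall>\<alpha>. Good f \<alpha> (f \<alpha>)"
  proof (rule dependent_wf_choice[OF wf_below])
    fix f g :: "'k \<Rightarrow> 'u \<times> 'p" and \<alpha> r
    assume "\<And>\<beta>. (\<beta>, \<alpha>) \<in> {(\<alpha>, \<beta>). \<alpha> \<sqsubset> \<beta>} \<Longrightarrow> f \<beta> = g \<beta>"
    then have "old f \<alpha> = old g \<alpha>" by (simp add: old_def)
    then show "Good f \<alpha> r = Good g \<alpha> r" by (simp add: Good_def)
  next
    fix f :: "'k \<Rightarrow> 'u \<times> 'p" and \<alpha>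
    assume IH: "\<And>\<beta>. (\<beta>, \<alpha>) \<in> {(\<alpha>, \<beta>). \<alpha> \<sqsubset> \<beta>} \<Longrightarrow> Good f \<beta> (f \<beta>)"
    show "\<exists>r. Good f \<alpha> r"
    proof (cases "\<alpha> \<in> Field m")
      case True
      let ?S = "\<lambda>\<beta>. old f \<beta> \<union> new \<beta> (f \<beta>)"
      have mono: "?S \<beta> \<subseteq> ?S \<gamma>" if "\<beta> \<sqsubset> \<gamma> \<or> \<beta> = \<gamma>" for \<beta> \<gamma>
        using that below_trans by (auto simp: old_def)
      have "coherent P d U (\<Union>\<beta>\<in>{\<beta>. \<beta> \<sqsubset> \<alpha>}. ?S \<beta>)"
      proof (rule coherent_directed_UN)
        fix \<beta> \<gamma> assume \<beta>\<gamma>: "\<beta> \<in> {\<beta>. \<beta> \<sqsubset> \<alpha>}" "\<gamma> \<in> {\<beta>. \<beta> \<sqsubset> \<alpha>}"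
        then have "\<beta> \<sqsubset> \<gamma> \<or> \<beta> = \<gamma> \<or> \<gamma> \<sqsubset> \<beta>" using below_total below_Field by blast
        then show "\<exists>\<delta>\<in>{\<beta>. \<beta> \<sqsubset> \<alpha>}. ?S \<beta> \<subseteq> ?S \<delta> \<and> ?S \<gamma> \<subseteq> ?S \<delta>"
          using mono \<beta>\<gamma> by blast
      next
        fix \<beta> assume "\<beta> \<in> {\<beta>. \<beta> \<sqsubset> \<alpha>}"
        then show "coherent P d U (?S \<beta>)"
          using IH[of \<beta>] below_Field by (auto simp: Good_def)
      qed
      moreover have "(\<Union>\<beta>\<in>{\<beta>. \<beta> \<sqsubset> \<alpha>}. ?S \<beta>) = old f \<alpha>"
        using below_trans by (auto simp: old_def)
      ultimately have old: "coherent P d U (old f \<alpha>)" by simp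
      have "old f \<alpha> = (\<lambda>\<beta>. (p \<beta>, fst (f \<beta>))) ` {\<beta>. \<beta> \<sqsubset> \<alpha>} \<union> (\<lambda>\<beta>. (snd (f \<beta>), q \<beta>)) ` {\<beta>. \<beta> \<sqsubset> \<alpha>}"
        by (auto simp: old_def new_def)
      then have small: "|old f \<alpha>| <o m"
        using card_below[OF True] by (simp add: card_Un_less card_image_less)
      obtain v where v: "coherent P d U (insert (p \<alpha>, v) (old f \<alpha>))"
        using forward[OF old small, of "p \<alpha>"] p D(1) True by blast
      have small': "|{(p \<alpha>, v)} \<union> old f \<alpha>| <o m"
        using small by (intro card_Un_less finite_card_less[of "{_}"]) auto
      then obtain y where "coherent P d U (insert (y, q \<alpha>) (insert (p \<alpha>, v) (old f \<alpha>)))"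
        using backward[OF v, of "q \<alpha>"] small' q E(1) True by auto
      moreover have "insert (y, q \<alpha>) (insert (p \<alpha>, v) (old f \<alpha>)) = old f \<alpha> \<union> new \<alpha> (v, y)"
        by (auto simp: new_def)
      ultimately show ?thesis by (auto simp: Good_def)
    qed (simp add: Good_def)
  qed
  then obtain f where f: "\<And>\<alpha>. \<alpha> \<in> Field m \<Longrightarrow> coherent P d U (old f \<alpha> \<union> new \<alpha> (f \<alpha>))"
    unfolding Good_def by blast
  let ?S = "\<lambda>\<beta>. old f \<beta> \<union> new \<beta> (f \<beta>)"
  show thesis
  proof (rule that[of "\<Union>\<alpha>\<in>Field m. ?S \<alpha>"])
    have mono: "?S \<beta> \<subseteq> ?S \<gamma>" if "\<beta> \<sqsubset> \<gamma> \<or> \<beta> = \<gamma>" for \<beta> \<gamma>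
      using that below_trans by (auto simp: old_def)
    show "coherent P d U (\<Union>\<alpha>\<in>Field m. ?S \<alpha>)"
    proof (rule coherent_directed_UN)
      fix \<beta> \<gamma> assume \<beta>\<gamma>: "\<beta> \<in> Field m" "\<gamma> \<in> Field m"
      then have "\<beta> \<sqsubset> \<gamma> \<or> \<beta> = \<gamma> \<or> \<gamma> \<sqsubset> \<beta>" by (rule below_total)
      then show "\<exists>\<delta>\<in>Field m. ?S \<beta> \<subseteq> ?S \<delta> \<and> ?S \<gamma> \<subseteq> ?S \<delta>"
        using mono \<beta>\<gamma> by blast
    qed (rule f)
    show "D \<subseteq> fst ` (\<Union>\<alpha>\<in>Field m. ?S \<alpha>)" "E \<subseteq> snd ` (\<Union>\<alpha>\<in>Field m. ?S \<alpha>)"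
      unfolding p[symmetric] q[symmetric] by (force simp: new_def)+
  qed
qed

end

section \<open>Extension of coherent relations by completeness\<close>

lemma coherent_limit:
  assumes P: "pseudometric_on P d" and R: "coherent P d U R" and U: "mcomplete_of U"
    and dense: "\<And>e. 0 < e \<Longrightarrow> \<exists>(a, b)\<in>R. d y a < e" and y: "y \<in> P"
  shows "\<exists>v\<in>mspace U. \<forall>(a, b)\<in>R. mdist U v b = d y a"
proof -
  interpret U: Metric_space "mspace U" "mdist U" by (rule Metric_space_mspace_mdist)
  note Pd = pseudometric_onD[OF P]
  have "\<exists>p\<in>R. d y (fst p) < inverse (real (Suc n))" for n
    using dense[of "inverse (real (Suc n))"] by force
  then obtain p where p: "\<And>n. p n \<in> R" "\<And>n. d y (fst (p n)) < inverse (real (Suc n))"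
    by metis
  have pP: "fst (p n) \<in> P" "snd (p n) \<in> mspace U" for n
    using coherentD[OF R, of "fst (p n)" "snd (p n)"] p(1) by auto
  have eq: "mdist U (snd (p i)) b = d (fst (p i)) a" if "(a, b) \<in> R" for i a b
    using coherentD(3)[OF R, of "fst (p i)" "snd (p i)" a b] p(1) that by simp
  have tri: "d (fst (p i)) a \<le> d y (fst (p i)) + d y a" "d y a \<le> d y (fst (p i)) + d (fst (p i)) a"
    if "a \<in> P" for i a
    using Pd(4)[OF pP(1) y that] Pd(4)[OF y pP(1) that] Pd(3)[OF y pP(1)] by auto
  have "U.MCauchy (\<lambda>n. snd (p n))"
    unfolding U.MCauchy_def
  proof (intro conjI allI impI)
    show "range (\<lambda>n. snd (p n)) \<subseteq> mspace U" using pP by blast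
    fix e :: real assume "0 < e"
    then obtain N where N: "inverse (real (Suc N)) < e / 2" using reals_Archimedean[of "e / 2"] by auto
    have close: "d y (fst (p n)) < e / 2" if "N \<le> n" for n
    proof -
      have "inverse (real (Suc n)) \<le> inverse (real (Suc N))" using that by simp
      then show ?thesis using p(2)[of n] N by linarith
    qed
    have "mdist U (snd (p n)) (snd (p n')) < e" if "N \<le> n" "N \<le> n'" for n n'
      using eq[of "fst (p n')" "snd (p n')" n] p(1)[of n'] tri(1)[OF pP(1), of n n'] close[OF that(1)] close[OF that(2)]
      by simp
    then show "\<exists>N. \<forall>n n'. N \<le> n \<longrightarrow> N \<le> n' \<longrightarrow> mdist U (snd (p n)) (snd (p n')) < e" by blast
  qed
  then obtain v where v: "limitin U.mtopology (\<lambda>n. snd (p n)) v sequentially"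
    using U unfolding mcomplete_of_def U.mcomplete_def by blast
  then have vU: "v \<in> mspace U" using U.limitin_mspace by blast
  have lim: "(\<lambda>n. mdist U (snd (p n)) v) \<longlonglongrightarrow> 0"
    using v by (simp add: U.limitin_metric_dist_null)
  have lim_p: "(\<lambda>n. d y (fst (p n))) \<longlonglongrightarrow> 0"
  proof (rule tendsto_sandwich[OF _ _ tendsto_const LIMSEQ_inverse_real_of_nat])
    show "\<forall>\<^sub>F n in sequentially. 0 \<le> d y (fst (p n))"
      using Pd(2)[OF y pP(1)] by simp
    show "\<forall>\<^sub>F n in sequentially. d y (fst (p n)) \<le> inverse (real (Suc n))"
      using p(2) by (simp add: less_imp_le)
  qed
  have "mdist U v b = d y a" if ab: "(a, b) \<in> R" for a b
  proof -
    note abP = coherentD(1,2)[OF R ab]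
    have "\<bar>mdist U v b - d y a\<bar> \<le> mdist U (snd (p n)) v + d y (fst (p n))" for n
      using U.triangle[OF vU pP(2) abP(2), of n] U.triangle[OF pP(2) vU abP(2), of n] tri[OF abP(1), of n]
        eq[OF ab, of n] U.commute[of v "snd (p n)"] by simp
    then have "\<bar>mdist U v b - d y a\<bar> \<le> 0 + 0"
      by (intro LIMSEQ_le_const[OF tendsto_add[OF lim lim_p]]) auto
    then show ?thesis by simp
  qed
  then show ?thesis using vU by blast
qed

text \<open>This serves twice: it extends the result of back and forth to all terms, and, with the
  space \<open>U\<close> itself as \<open>P\<close>, it extends the action of a group element from
  the dense image of the tower to \<open>U\<close>.\<close>

lemma coherent_extend:
  assumes P: "pseudometric_on P d" and R: "coherent P d U R" and U: "mcomplete_of U"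
    and dense: "\<And>y e. y \<in> P \<Longrightarrow> 0 < e \<Longrightarrow> \<exists>(a, b)\<in>R. d y a < e"
  obtains \<phi> where "\<And>y. y \<in> P \<Longrightarrow> \<phi> y \<in> mspace U"
    "\<And>y a b. y \<in> P \<Longrightarrow> (a, b) \<in> R \<Longrightarrow> mdist U (\<phi> y) b = d y a"
    "\<And>y z. y \<in> P \<Longrightarrow> z \<in> P \<Longrightarrow> mdist U (\<phi> y) (\<phi> z) = d y z"
proof -
  note Pd = pseudometric_onD[OF P]
  have "\<forall>y\<in>P. \<exists>v\<in>mspace U. \<forall>(a, b)\<in>R. mdist U v b = d y a"
    using coherent_limit[OF P R U dense] by blast
  then obtain \<phi> where "\<forall>y\<in>P. \<phi> y \<in> mspace U \<and> (\<forall>(a, b)\<in>R. mdist U (\<phi> y) b = d y a)"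
    unfolding Bex_def by (rule bchoice[THEN exE])
  then have \<phi>: "\<And>y. y \<in> P \<Longrightarrow> \<phi> y \<in> mspace U"
    "\<And>y a b. y \<in> P \<Longrightarrow> (a, b) \<in> R \<Longrightarrow> mdist U (\<phi> y) b = d y a"
    by blast+
  have "mdist U (\<phi> y) (\<phi> z) = d y z" if yz: "y \<in> P" "z \<in> P" for y z
  proof -
    have "\<bar>mdist U (\<phi> y) (\<phi> z) - d y z\<bar> \<le> 0 + e" if "0 < e" for e
    proof -
      obtain a b where ab: "(a, b) \<in> R" "d z a < e / 2" using dense[OF yz(2), of "e / 2"] \<open>0 < e\<close> by auto
      note abP = coherentD(1,2)[OF R ab(1)]
      show ?thesis
        using mdist_triangle[OF \<phi>(1)[OF yz(1)] abP(2) \<phi>(1)[OF yz(2)]]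
          mdist_triangle[OF \<phi>(1)[OF yz(1)] \<phi>(1)[OF yz(2)] abP(2)]
          Pd(4)[OF yz(1) abP(1) yz(2)] Pd(4)[OF yz(1) yz(2) abP(1)] Pd(3)[OF yz(2) abP(1)]
          \<phi>(2)[OF yz(1) ab(1)] \<phi>(2)[OF yz(2) ab(1)] ab(2) mdist_commute[of U b "\<phi> z"] by linarith
    qed
    then have "\<bar>mdist U (\<phi> y) (\<phi> z) - d y z\<bar> \<le> 0" by (rule field_le_epsilon)
    then show ?thesis by simp
  qed
  then show thesis using that \<phi> by blast
qed

subsection \<open>The action on the tower\<close>

locale normed_P_group = topgroup G T + power_closed_cardinal m
  for G :: "('g, 'b) monoid_scheme" (structure) and T :: "'g topology" and m :: "'k rel" +
  fixes \<V> :: "'g set set" and N :: "'g set \<Rightarrow> 'g \<Rightarrow> real"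
  assumes P_space: "P_space m T" and Hausdorff: "Hausdorff_space T" and weight_le: "weight T \<le>o m"
    and card_\<V>: "|\<V>| \<le>o m"
    and \<V>_nbhd: "\<And>V. openin T V \<Longrightarrow> \<one> \<in> V \<Longrightarrow> \<exists>W\<in>\<V>. W \<subseteq> V"
    and N_one: "\<And>V. V \<in> \<V> \<Longrightarrow> N V \<one> = 0"
    and N_range: "\<And>V g. V \<in> \<V> \<Longrightarrow> g \<in> carrier G \<Longrightarrow> 0 \<le> N V g \<and> N V g \<le> 1"
    and N_mult: "\<And>V g h. V \<in> \<V> \<Longrightarrow> g \<in> carrier G \<Longrightarrow> h \<in> carrier G \<Longrightarrow> N V (g \<otimes> h) \<le> N V g + N V h"
    and N_inv: "\<And>V g. V \<in> \<V> \<Longrightarrow> g \<in> carrier G \<Longrightarrow> N V (inv g) = N V g"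
    and N_less: "\<And>V g. V \<in> \<V> \<Longrightarrow> g \<in> carrier G \<Longrightarrow> N V g < 1/2 \<Longrightarrow> g \<in> V"
    and N_cont: "\<And>V e. V \<in> \<V> \<Longrightarrow> 0 < e \<Longrightarrow> \<exists>W. openin T W \<and> \<one> \<in> W \<and> (\<forall>g\<in>W. N V g < e)"
begin

text \<open>Since the norms are bounded by 1, distinct copies of the group may be placed at distance 1.\<close>

definition base_dist :: "'g set \<times> 'g \<Rightarrow> 'g set \<times> 'g \<Rightarrow> real" where
  "base_dist p q = (if fst p = fst q then N (fst p) (inv (snd p) \<otimes> snd q) else 1)"

definition base_act :: "'g \<Rightarrow> 'g set \<times> 'g \<Rightarrow> 'g set \<times> 'g" where
  "base_act g p = (fst p, g \<otimes> snd p)"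

lemma base_dist_pseudometric: "pseudometric_on (\<V> \<times> carrier G) base_dist"
proof -
  let ?X = "\<V> \<times> carrier G"
  have refl: "base_dist p p = 0" if "p \<in> ?X" for p
    using that N_one by (auto simp: base_dist_def)
  have sym: "0 \<le> base_dist p q \<and> base_dist p q = base_dist q p" if pq: "p \<in> ?X" "q \<in> ?X" for p q
  proof -
    have "N V (inv g \<otimes> h) = N V (inv h \<otimes> g)" if "V \<in> \<V>" "g \<in> carrier G" "h \<in> carrier G" for V g h
      using N_inv[of V "inv g \<otimes> h"] that by (simp add: inv_mult_group)
    then show ?thesis using pq N_range by (auto simp: base_dist_def)
  qed
  have tri: "base_dist p s \<le> base_dist p q + base_dist q s" if pqs: "p \<in> ?X" "q \<in> ?X" "s \<in> ?X" for p q s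
  proof -
    have "N V (inv g \<otimes> k) \<le> N V (inv g \<otimes> h) + N V (inv h \<otimes> k)"
      if "V \<in> \<V>" "g \<in> carrier G" "h \<in> carrier G" "k \<in> carrier G" for V g h k
    proof -
      have "inv g \<otimes> h \<otimes> (inv h \<otimes> k) = inv g \<otimes> k"
        using that by (simp add: m_assoc) (simp add: m_assoc[symmetric])
      then show ?thesis using N_mult[of V "inv g \<otimes> h" "inv h \<otimes> k"] that by simp
    qed
    \<comment> \<open>The bound 2 is for a detour from one copy of the group through another and
      back, of length 1 + 1.\<close>
    moreover have "N V (inv g \<otimes> h) \<le> 1" "N V (inv g \<otimes> h) \<le> 2" "0 \<le> N V (inv g \<otimes> h)"
      if "V \<in> \<V>" "g \<in> carrier G" "h \<in> carrier G" for V g h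
      using that N_range[of V "inv g \<otimes> h"] by fastforce+
    moreover obtain V g V' h V'' k where "p = (V, g)" "q = (V', h)" "s = (V'', k)"
      by (cases p; cases q; cases s)
    ultimately show ?thesis
      using pqs by (cases "V = V'"; cases "V' = V''"; cases "V = V''") (simp_all add: base_dist_def)
  qed
  show ?thesis
    unfolding pseudometric_on_def
    by (intro conjI ballI;
      (rule refl | rule sym[THEN conjunct1] | rule sym[THEN conjunct2] | rule tri); assumption)
qed

sublocale katetov_tower m "\<V> \<times> carrier G" base_dist
proof
  show "\<V> \<times> carrier G \<noteq> {}"
    using \<V>_nbhd[OF open_carrier] by auto
qed (rule base_dist_pseudometric)

definition act :: "'g \<Rightarrow> ('g set \<times> 'g, 'k) kterm \<Rightarrow> ('g set \<times> 'g, 'k) kterm"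
  where "act g = map_kterm (base_act g)"

lemma base_act_image: "g \<in> carrier G \<Longrightarrow> base_act g ` (\<V> \<times> carrier G) \<subseteq> \<V> \<times> carrier G"
  by (auto simp: base_act_def)

lemma act_terms: "g \<in> carrier G \<Longrightarrow> t \<in> terms \<Longrightarrow> act g t \<in> terms"
  using map_kterm_terms[OF base_act_image] by (simp add: act_def)

lemma act_one: "t \<in> terms \<Longrightarrow> act \<one> t = t"
  unfolding act_def
  by (induction rule: terms.induct) (auto simp: base_act_def fun_eq_iff)

lemma act_mult:
  assumes "g \<in> carrier G" "h \<in> carrier G" "t \<in> terms"
  shows "act (g \<otimes> h) t = act g (act h t)"
  using assms(3) unfolding act_def
  by (induction rule: terms.induct) (use assms(1,2) in \<open>auto simp: base_act_def fun_eq_iff m_assoc\<close>)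

lemma kdist_act:
  assumes g: "g \<in> carrier G" and "x \<in> terms" "y \<in> terms"
  shows "kdist (act g x) (act g y) = kdist x y"
  unfolding act_def
proof (rule kdist_map_kterm[OF _ _ _ _ assms(2,3)])
  show "base_act g ` (\<V> \<times> carrier G) \<subseteq> \<V> \<times> carrier G"
    "base_act (inv g) ` (\<V> \<times> carrier G) \<subseteq> \<V> \<times> carrier G"
    using g base_act_image by auto
  show "base_act g (base_act (inv g) p) = p" if "p \<in> \<V> \<times> carrier G" for p
    using that g by (auto simp: base_act_def m_assoc[symmetric])
  fix p q assume "p \<in> \<V> \<times> carrier G" "q \<in> \<V> \<times> carrier G"
  moreover have "inv (g \<otimes> h) \<otimes> (g \<otimes> k) = inv h \<otimes> k" if "h \<in> carrier G" "k \<in> carrier G" for h k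
  proof -
    have "inv (g \<otimes> h) \<otimes> (g \<otimes> k) = inv h \<otimes> (inv g \<otimes> g) \<otimes> k"
      using that g unfolding inv_mult_group[OF g that(1)] by (simp only: m_assoc m_closed inv_closed)
    then show ?thesis using that g by simp
  qed
  ultimately show "base_dist (base_act g p) (base_act g q) = base_dist p q"
    by (auto simp: base_dist_def base_act_def)
qed

text \<open>This is where the hypothesis on intersections of fewer than \<open>m\<close> open sets enters.\<close>

lemma act_continuous_at_one:
  assumes "t \<in> terms" "0 < e"
  shows "\<exists>W. openin T W \<and> \<one> \<in> W \<and> (\<forall>g\<in>W. kdist t (act g t) < e)"
  using assms
proof (induction arbitrary: e rule: terms.induct)
  case (Base p)
  then obtain V h where p: "p = (V, h)" "V \<in> \<V>" "h \<in> carrier G" by auto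
  obtain W where W: "openin T W" "\<one> \<in> W" "\<And>g. g \<in> W \<Longrightarrow> N V g < e"
    using N_cont[OF p(2) Base.prems] by blast
  have "continuous_map T T (\<lambda>g. g \<otimes> h)"
  proof -
    have "continuous_map T (prod_topology T T) (\<lambda>x. (x, h))"
      using p topspace_eq by (auto simp: continuous_map_pairwise o_def)
    then have "continuous_map T T ((\<lambda>(x, y). x \<otimes> y) \<circ> (\<lambda>x. (x, h)))"
      using topological_group continuous_map_compose unfolding topological_group_def by blast
    then show ?thesis by (simp add: o_def)
  qed
  \<comment> \<open>Translation by \<open>g\<close> moves \<open>(V, h)\<close> by
    \<open>N V (inv h \<otimes> (g \<otimes> h))\<close>, so \<open>W\<close> is pulled back under
    conjugation by \<open>h\<close>.\<close>
  from openin_continuous_map_preimage[OF this open_translate[OF W(1), of "inv h"]]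
  have "openin T {g \<in> carrier G. g \<otimes> h \<in> carrier G \<and> inv h \<otimes> (g \<otimes> h) \<in> W}"
    using p by (simp add: topspace_eq)
  moreover have "kdist (kterm.Base p) (act g (kterm.Base p)) < e"
    if "g \<in> {g \<in> carrier G. g \<otimes> h \<in> carrier G \<and> inv h \<otimes> (g \<otimes> h) \<in> W}" for g
    using that W(3) by (simp add: act_def base_act_def base_dist_def p)
  ultimately show ?case
    using p W(2) by (intro exI[of _ "{g \<in> carrier G. g \<otimes> h \<in> carrier G \<and> inv h \<otimes> (g \<otimes> h) \<in> W}"]) auto
next
  case (Node \<alpha> s r)
  have t: "kterm.Node \<alpha> s r \<in> terms" using Node.hyps by (intro terms.Node) auto
  have "\<exists>W. openin T W \<and> \<one> \<in> W \<and> (\<forall>g\<in>W. kdist (s i) (act g (s i)) < e / 8)" for i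
    using Node.IH[of "e / 8" i] Node.prems by simp
  then obtain W where W: "\<And>i. openin T (W i)" "\<And>i. \<one> \<in> W i"
    "\<And>i g. g \<in> W i \<Longrightarrow> kdist (s i) (act g (s i)) < e / 8"
    by metis
  \<comment> \<open>Children are indexed by a whole type, but only those in the segment affect
    distances, so fewer than m neighbourhoods are intersected.\<close>
  let ?W = "topspace T \<inter> \<Inter>(W ` segment \<alpha>)"
  have "openin T ?W"
    using P_space W(1) card_image_less[OF card_segment[OF Node.hyps(1)], of W]
    unfolding P_space_def by blast
  moreover have "kdist (kterm.Node \<alpha> s r) (act g (kterm.Node \<alpha> s r)) < e" if g: "g \<in> ?W" for g
  proof -
    have "g \<in> carrier G" using g topspace_eq by blast
    then have "kterm.Node \<alpha> (act g \<circ> s) r \<in> terms"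
      using act_terms[OF _ t, of g] by (simp add: act_def)
    then have "kdist (kterm.Node \<alpha> s r) (kterm.Node \<alpha> (act g \<circ> s) r) \<le> 4 * (e / 8)"
      using t g W(3) Node.prems by (intro kdist_Node_close) (auto intro: less_imp_le)
    then show ?thesis using Node.prems by (simp add: act_def)
  qed
  ultimately show ?case using W(2) topspace_eq by (intro exI[of _ ?W]) auto
qed

section \<open>Dense embedding of the tower into U\<close>

lemma small_dense_terms:
  "\<exists>D\<subseteq>terms. |D| \<le>o m \<and> D \<noteq> {} \<and> (\<forall>t\<in>terms. \<forall>e>0. \<exists>t'\<in>D. kdist t t' < e)"
proof -
  obtain \<B> where \<B>: "base_of_topology T \<B>" "weight T = |\<B>|"
    by (rule weight_attained[of T])
  obtain D where D: "D \<subseteq> topspace T" "|D| \<le>o |\<B>|" "\<forall>V. openin T V \<and> V \<noteq> {} \<longrightarrow> D \<inter> V \<noteq> {}"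
    using dense_set_of_base[OF \<B>(1)] by blast
  let ?X0 = "\<V> \<times> D"
  have X0: "?X0 \<subseteq> \<V> \<times> carrier G" using D(1) topspace_eq by auto
  have card: "|?X0| \<le>o m"
    using card_\<V> ordLeq_transitive[OF D(2) weight_le[unfolded \<B>(2)]] by (rule card_Times_le)
  \<comment> \<open>Every \<open>N V\<close> is small near the identity, so one dense subset of the
    group is dense in all copies.\<close>
  have dense: "\<exists>q\<in>?X0. base_dist p q < e" if pe: "p \<in> \<V> \<times> carrier G" "0 < e" for p e
  proof -
    obtain V g where p: "p = (V, g)" "V \<in> \<V>" "g \<in> carrier G" using pe(1) by auto
    obtain W where W: "openin T W" "\<one> \<in> W" "\<And>g. g \<in> W \<Longrightarrow> N V g < e"
      using N_cont[OF p(2) pe(2)] by blast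
    have "g \<in> {x \<in> carrier G. inv g \<otimes> x \<in> W}" using p W(2) by simp
    then obtain h where "h \<in> D" "inv g \<otimes> h \<in> W"
      using D(3)[rule_format, of "{x \<in> carrier G. inv g \<otimes> x \<in> W}"] open_translate[OF W(1), of "inv g"] p(3)
      by blast
    then show ?thesis using W(3) p by (intro bexI[of _ "(V, h)"]) (auto simp: base_dist_def)
  qed
  obtain x0 where x0: "x0 \<in> ?X0"
    using dense X_nonempty zero_less_one by blast
  note rat = X0 card dense x0
  have "rational_terms ?X0 x0 \<noteq> {}" using rational_Base[OF rat x0] by blast
  moreover have "\<forall>t\<in>terms. \<forall>e>0. \<exists>t'\<in>rational_terms ?X0 x0. kdist t t' < e"
    using rational_terms_dense[OF rat] by blast
  ultimately show ?thesis
    using rational_terms_subset[OF rat] card_rational_terms[OF rat] by blast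
qed

text \<open>\<open>forward\<close> rests on \<open>realize_katetov\<close> and
  \<open>backward\<close> on \<open>extension_property\<close>. The image is dense because the
  relation obtained covers a dense set \<open>E\<close> of \<open>U\<close>.\<close>

lemma ex_dense_isometry:
  assumes U: "Urysohn_Katetov m U"
  obtains \<phi> where "\<And>t. t \<in> terms \<Longrightarrow> \<phi> t \<in> mspace U"
    "\<And>t t'. t \<in> terms \<Longrightarrow> t' \<in> terms \<Longrightarrow> mdist U (\<phi> t) (\<phi> t') = kdist t t'"
    "\<And>u e. u \<in> mspace U \<Longrightarrow> 0 < e \<Longrightarrow> \<exists>t\<in>terms. mdist U u (\<phi> t) < e"
proof -
  interpret U: Metric_space "mspace U" "mdist U" by (rule Metric_space_mspace_mdist)
  have complete: "mcomplete_of U" and weightU: "weight (mtopology_of U) \<le>o m"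
    and univ: "universal_metric m U" and hom: "homogeneous_metric m U"
    using U ordIso_imp_ordLeq by (auto simp: Urysohn_Katetov_def)
  obtain D where D: "D \<subseteq> terms" "|D| \<le>o m" "D \<noteq> {}"
    and D_dense: "\<forall>t\<in>terms. \<forall>e>0. \<exists>t'\<in>D. kdist t t' < e"
    using small_dense_terms by blast
  obtain \<B> where \<B>: "base_of_topology (mtopology_of U) \<B>" "weight (mtopology_of U) = |\<B>|"
    by (rule weight_attained[of "mtopology_of U"])
  obtain E where E: "E \<subseteq> mspace U" "|E| \<le>o |\<B>|"
    "\<forall>V. openin (mtopology_of U) V \<and> V \<noteq> {} \<longrightarrow> E \<inter> V \<noteq> {}"
    using dense_set_of_base[OF \<B>(1)] unfolding topspace_mtopology_of by blast
  have E_dense: "\<exists>v\<in>E. mdist U u v < e" if "u \<in> mspace U" "0 < e" for u e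
  proof -
    have "u \<in> U.mball u e" using that by simp
    then have "E \<inter> U.mball u e \<noteq> {}"
      using E(3) U.openin_mball[of u e] unfolding mtopology_of_def by blast
    then show ?thesis by auto
  qed
  have cardE: "|E| \<le>o m"
    using E(2) weightU[unfolded \<B>(2)] by (rule ordLeq_transitive)
  \<comment> \<open>Realizing the empty Katetov function produces a point.\<close>
  have "mspace U \<noteq> {}"
    using realize_katetov[OF univ hom, of "{}"] finite_card_less[of "{}"] by (auto simp: katetov_on_def)
  then have E_nonempty: "E \<noteq> {}"
    using E_dense zero_less_one by blast
  have forward: "\<exists>v. coherent terms kdist U (insert (y, v) R)"
    if R: "coherent terms kdist U R" "|R| <o m" and y: "y \<in> terms" for R y
  proof -
    \<comment> \<open>All terms related to the same \<open>b\<close> are at mutual distance 0, so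
      any choice among them gives the same distances.\<close>
    define c where "c b = (SOME a. (a, b) \<in> R)" for b
    have c: "(c b, b) \<in> R" if "b \<in> snd ` R" for b
      using that unfolding c_def by (auto intro: someI)
    have cterm: "c b \<in> terms" "b \<in> mspace U" if "b \<in> snd ` R" for b
      using coherentD(1,2)[OF R(1) c[OF that]] .
    have cdist: "mdist U b b' = kdist (c b) (c b')" if "b \<in> snd ` R" "b' \<in> snd ` R" for b b'
      using coherentD(3)[OF R(1) c[OF that(1)] c[OF that(2)]] by simp
    have "katetov_on (snd ` R) (mdist U) (\<lambda>b. kdist y (c b))"
      unfolding katetov_on_def
    proof (intro ballI)
      fix b b' assume b: "b \<in> snd ` R" "b' \<in> snd ` R"
      show "kdist y (c b) \<le> kdist y (c b') + mdist U b b' \<and> mdist U b b' \<le> kdist y (c b) + kdist y (c b')"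
        unfolding cdist[OF b]
        using kdist_rules(4)[OF y cterm(1)[OF b(2)] cterm(1)[OF b(1)]]
          kdist_rules(4)[OF cterm(1)[OF b(1)] y cterm(1)[OF b(2)]]
          kdist_rules(3)[OF y cterm(1)[OF b(1)]] kdist_rules(3)[OF cterm(1)[OF b(1)] cterm(1)[OF b(2)]]
        by simp
    qed
    then obtain v where v: "v \<in> mspace U" "\<And>b. b \<in> snd ` R \<Longrightarrow> mdist U v b = kdist y (c b)"
      using realize_katetov[OF univ hom _ card_image_less[OF R(2), of snd]] cterm(2) by blast
    have "kdist y a = mdist U v b" if ab: "(a, b) \<in> R" for a b
    proof -
      have b: "b \<in> snd ` R" using ab by force
      note a = coherentD(1)[OF R(1) ab]
      have "kdist a (c b) = 0"
        using coherentD(3)[OF R(1) ab c[OF b]] cterm(2)[OF b] by simp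
      then have "kdist y a = kdist y (c b)"
        using kdist_rules(4)[OF y a cterm(1)[OF b]] kdist_rules(4)[OF y cterm(1)[OF b] a]
          kdist_rules(3)[OF a cterm(1)[OF b]] by simp
      then show ?thesis using v(2)[OF b] by simp
    qed
    then show ?thesis
      using coherent_insert[OF pseudometric_kdist R(1) y v(1)] by blast
  qed
  have backward: "\<exists>y. coherent terms kdist U (insert (y, v) R)"
    if R: "coherent terms kdist U R" "|R| <o m" and v: "v \<in> mspace U" for R v
  proof -
    have mem: "fst p \<in> terms" "snd p \<in> mspace U" if "p \<in> R" for p
      using coherentD(1,2)[OF R(1), of "fst p" "snd p"] that by auto
    have eq: "kdist (fst p) (fst q) = mdist U (snd p) (snd q)" if "p \<in> R" "q \<in> R" for p q
      using coherentD(3)[OF R(1), of "fst p" "snd p" "fst q" "snd q"] that by simp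
    \<comment> \<open>The pairs of \<open>R\<close> index the prescribed distances, so no term has
      to be chosen for a point of \<open>U\<close>.\<close>
    have "\<exists>y\<in>terms. \<forall>p\<in>R. kdist y (fst p) = mdist U v (snd p)"
    proof (rule extension_property[OF R(2)])
      show "fst ` R \<subseteq> terms" using mem by blast
      fix p q assume p: "p \<in> R" and q: "q \<in> R"
      show "mdist U v (snd p) \<le> mdist U v (snd q) + kdist (fst p) (fst q) \<and>
          kdist (fst p) (fst q) \<le> mdist U v (snd p) + mdist U v (snd q)"
        using mdist_triangle[OF v mem(2)[OF q] mem(2)[OF p]] mdist_triangle[OF mem(2)[OF p] v mem(2)[OF q]]
          mdist_commute[of U "snd p"] eq[OF p q] by simp
    qed
    then obtain y where y: "y \<in> terms" "\<And>p. p \<in> R \<Longrightarrow> kdist y (fst p) = mdist U v (snd p)"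
      by blast
    have "kdist y a = mdist U v b" if "(a, b) \<in> R" for a b
      using y(2)[OF that] by simp
    then show ?thesis
      using coherent_insert[OF pseudometric_kdist R(1) y(1) v] by blast
  qed
  obtain R where R: "coherent terms kdist U R" "D \<subseteq> fst ` R" "E \<subseteq> snd ` R"
    using back_and_forth[of terms kdist U D E, OF forward backward D E(1) cardE E_nonempty] by blast
  have dense: "\<exists>(a, b)\<in>R. kdist y a < e" if ye: "y \<in> terms" "0 < e" for y e
  proof -
    obtain a where "a \<in> D" "kdist y a < e" using D_dense ye by blast
    then show ?thesis using R(2) by fastforce
  qed
  obtain \<phi> where \<phi>: "\<And>y. y \<in> terms \<Longrightarrow> \<phi> y \<in> mspace U"
    "\<And>y a b. y \<in> terms \<Longrightarrow> (a, b) \<in> R \<Longrightarrow> mdist U (\<phi> y) b = kdist y a"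
    "\<And>y z. y \<in> terms \<Longrightarrow> z \<in> terms \<Longrightarrow> mdist U (\<phi> y) (\<phi> z) = kdist y z"
    using coherent_extend[OF pseudometric_kdist R(1) complete dense] by blast
  have "\<exists>t\<in>terms. mdist U u (\<phi> t) < e" if u: "u \<in> mspace U" "0 < e" for u e
  proof -
    obtain b where b: "b \<in> E" "mdist U u b < e" using E_dense[OF u] by blast
    then obtain a where ab: "(a, b) \<in> R" using R(3) by force
    note a = coherentD(1,2)[OF R(1) ab]
    have "mdist U (\<phi> a) b = 0"
      using \<phi>(2)[OF a(1) ab] kdist_rules(1)[OF a(1) a(1)] by simp
    then have "\<phi> a = b" using mdist_zero[OF \<phi>(1)[OF a(1)] a(2)] by simp
    then show ?thesis using a(1) b(2) by blast
  qed
  then show thesis using that \<phi>(1,3) by blast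
qed

end

subsection \<open>The representation on the Urysohn--Katetov space\<close>

locale dense_isometry = normed_P_group G T m \<V> N
  for G :: "('g, 'b) monoid_scheme" (structure) and T :: "'g topology" and m :: "'k rel"
    and \<V> :: "'g set set" and N :: "'g set \<Rightarrow> 'g \<Rightarrow> real" +
  fixes U :: "'u metric" and \<phi> :: "('g set \<times> 'g, 'k) kterm \<Rightarrow> 'u"
  assumes complete: "mcomplete_of U"
    and \<phi>_mem: "\<And>t. t \<in> terms \<Longrightarrow> \<phi> t \<in> mspace U"
    and \<phi>_dist: "\<And>t t'. t \<in> terms \<Longrightarrow> t' \<in> terms \<Longrightarrow> mdist U (\<phi> t) (\<phi> t') = kdist t t'"
    and \<phi>_dense: "\<And>u e. u \<in> mspace U \<Longrightarrow> 0 < e \<Longrightarrow> \<exists>t\<in>terms. mdist U u (\<phi> t) < e"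
begin

sublocale U: Metric_space "mspace U" "mdist U"
  by (rule Metric_space_mspace_mdist)

text \<open>Distances to the dense image determine \<open>f u\<close>. Stated this way, uniqueness
  (\<open>rep_eqI\<close>) yields the product law for \<open>rep\<close> without a further passage
  to limits.\<close>

definition extends :: "'g \<Rightarrow> ('u \<Rightarrow> 'u) \<Rightarrow> bool" where
  "extends g f \<longleftrightarrow> (\<forall>u\<in>mspace U. f u \<in> mspace U \<and> (\<forall>t\<in>terms. mdist U (f u) (\<phi> (act g t)) = mdist U u (\<phi> t))) \<and>
     (\<forall>u\<in>mspace U. \<forall>v\<in>mspace U. mdist U (f u) (f v) = mdist U u v)"

lemma ex_extends:
  assumes g: "g \<in> carrier G"
  shows "\<exists>f. extends g f"
proof -
  define R where "R = (\<lambda>t. (\<phi> t, \<phi> (act g t))) ` terms"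
  have P: "pseudometric_on (mspace U) (mdist U)"
    unfolding pseudometric_on_def by (auto simp: U.commute U.triangle)
  have R: "coherent (mspace U) (mdist U) U R"
    unfolding coherent_def R_def using g by (auto simp: \<phi>_mem \<phi>_dist act_terms kdist_act)
  have dense: "\<exists>(a, b)\<in>R. mdist U y a < e" if "y \<in> mspace U" "0 < e" for y e
    using \<phi>_dense[OF that] by (auto simp: R_def)
  obtain f where "\<And>y. y \<in> mspace U \<Longrightarrow> f y \<in> mspace U"
    "\<And>y a b. y \<in> mspace U \<Longrightarrow> (a, b) \<in> R \<Longrightarrow> mdist U (f y) b = mdist U y a"
    "\<And>y z. y \<in> mspace U \<Longrightarrow> z \<in> mspace U \<Longrightarrow> mdist U (f y) (f z) = mdist U y z"
    using coherent_extend[OF P R complete dense] by metis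
  then show ?thesis
    unfolding extends_def by (intro exI[of _ f]) (auto simp: R_def)
qed

definition rep :: "'g \<Rightarrow> 'u \<Rightarrow> 'u"
  where "rep g = restrict (SOME f. extends g f) (mspace U)"

context
  fixes g assumes g: "g \<in> carrier G"
begin

lemma rep_extends: "extends g (SOME f. extends g f)"
  using ex_extends[OF g] by (rule someI_ex)

lemma rep_mem: "u \<in> mspace U \<Longrightarrow> rep g u \<in> mspace U"
  and rep_act: "u \<in> mspace U \<Longrightarrow> t \<in> terms \<Longrightarrow> mdist U (rep g u) (\<phi> (act g t)) = mdist U u (\<phi> t)"
  and rep_dist: "u \<in> mspace U \<Longrightarrow> v \<in> mspace U \<Longrightarrow> mdist U (rep g u) (rep g v) = mdist U u v"
  using rep_extends by (simp_all add: extends_def rep_def)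

lemma rep_eqI:
  assumes u: "u \<in> mspace U" and w: "w \<in> mspace U"
    and eq: "\<And>t. t \<in> terms \<Longrightarrow> mdist U w (\<phi> (act g t)) = mdist U u (\<phi> t)"
  shows "rep g u = w"
proof -
  have "mdist U (rep g u) w \<le> 0 + e" if "0 < e" for e
  proof -
    obtain t where t: "t \<in> terms" "mdist U u (\<phi> t) < e / 2"
      using \<phi>_dense[OF u, of "e / 2"] \<open>0 < e\<close> by auto
    have "mdist U (rep g u) w \<le> mdist U (rep g u) (\<phi> (act g t)) + mdist U (\<phi> (act g t)) w"
      using rep_mem[OF u] w \<phi>_mem[OF act_terms[OF g t(1)]] by (intro U.triangle)
    then show ?thesis
      using rep_act[OF u t(1)] eq[OF t(1)] t(2) U.commute[of w] by simp
  qed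
  then have "mdist U (rep g u) w \<le> 0" by (rule field_le_epsilon)
  then show ?thesis
    using U.zero[OF rep_mem[OF u] w] U.nonneg[of "rep g u" w] by simp
qed

lemma rep_\<phi>: "t \<in> terms \<Longrightarrow> rep g (\<phi> t) = \<phi> (act g t)"
  by (rule rep_eqI) (auto simp: \<phi>_mem \<phi>_dist act_terms kdist_act g)

end

section \<open>The homomorphism into the isometry group\<close>

lemma rep_mult:
  assumes g: "g \<in> carrier G" and h: "h \<in> carrier G" and u: "u \<in> mspace U"
  shows "rep (g \<otimes> h) u = rep g (rep h u)"
proof (rule rep_eqI)
  fix t assume t: "t \<in> terms"
  have "mdist U (rep g (rep h u)) (\<phi> (act (g \<otimes> h) t)) = mdist U (rep h u) (\<phi> (act h t))"
    using rep_act[OF g rep_mem[OF h u] act_terms[OF h t]] act_mult[OF g h t] by simp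
  then show "mdist U (rep g (rep h u)) (\<phi> (act (g \<otimes> h) t)) = mdist U u (\<phi> t)"
    using rep_act[OF h u t] by simp
qed (use g h u rep_mem in auto)

lemma rep_one: "u \<in> mspace U \<Longrightarrow> rep \<one> u = u"
  by (rule rep_eqI) (auto simp: act_one)

text \<open>An isometric embedding of \<open>U\<close> into itself need not be onto; surjectivity
  comes from the inverse group element.\<close>

lemma rep_Iso:
  assumes g: "g \<in> carrier G"
  shows "rep g \<in> carrier (Iso U)"
proof -
  have inv: "rep g (rep (inv g) u) = u" "rep (inv g) (rep g u) = u" if "u \<in> mspace U" for u
    using that g rep_mult[of g "inv g" u] rep_mult[of "inv g" g u] rep_one[of u] by auto
  have bij: "bij_betw (rep g) (mspace U) (mspace U)"
    by (rule bij_betw_byWitness[of _ "rep (inv g)"]) (use inv g rep_mem in auto)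
  have "rep g \<in> extensional (mspace U)" by (simp add: rep_def)
  with bij have "rep g \<in> Bij (mspace U)" by (simp add: Bij_def)
  moreover have "isometry U U (rep g)"
    unfolding isometry_def isometric_embedding_def
    using rep_mem[OF g] rep_dist[OF g] bij_betw_imp_surj_on[OF bij] by auto
  ultimately show ?thesis by (simp add: Iso_def)
qed

lemma Iso_mult:
  assumes "f \<in> carrier (Iso U)" "h \<in> carrier (Iso U)"
  shows "f \<otimes>\<^bsub>Iso U\<^esub> h = compose (mspace U) f h"
  using assms by (simp add: Iso_def BijGroup_def)

lemma rep_hom: "rep \<in> hom G (Iso U)"
proof (rule homI)
  fix g h assume g: "g \<in> carrier G" and h: "h \<in> carrier G"
  have "rep (g \<otimes> h) = compose (mspace U) (rep g) (rep h)"
  proof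
    fix u
    show "rep (g \<otimes> h) u = compose (mspace U) (rep g) (rep h) u"
      using rep_mult[OF g h, of u] by (cases "u \<in> mspace U") (simp_all add: compose_def rep_def)
  qed
  then show "rep (g \<otimes> h) = rep g \<otimes>\<^bsub>Iso U\<^esub> rep h"
    using Iso_mult rep_Iso g h by simp
qed (rule rep_Iso)

text \<open>The orbits of the points \<open>(V, 1)\<close> of the base space recover the topology of the group.\<close>

lemma rep_nbhd:
  assumes V: "V \<in> \<V>" and g: "g \<in> carrier G" and h: "h \<in> carrier G"
    and less: "mdist U (rep g (\<phi> (kterm.Base (V, \<one>)))) (rep h (\<phi> (kterm.Base (V, \<one>)))) < 1/2"
  shows "inv g \<otimes> h \<in> V"
proof -
  have t: "kterm.Base (V, \<one>) \<in> terms" using V by simp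
  have "mdist U (rep g (\<phi> (kterm.Base (V, \<one>)))) (rep h (\<phi> (kterm.Base (V, \<one>)))) =
      kdist (act g (kterm.Base (V, \<one>))) (act h (kterm.Base (V, \<one>)))"
    using g h t by (simp add: rep_\<phi> \<phi>_dist act_terms)
  also have "\<dots> = N V (inv g \<otimes> h)"
    using g h by (simp add: act_def base_act_def base_dist_def)
  finally show ?thesis using less N_less[OF V] g h by simp
qed

text \<open>If \<open>g\<close> and \<open>h\<close> act alike, \<open>inv g \<otimes> h\<close>
  lies in every member of \<V>. These form a neighbourhood base at the identity, whose intersection
  is trivial in a Hausdorff group.\<close>

lemma rep_inj: "inj_on rep (carrier G)"
proof
  fix g h assume g: "g \<in> carrier G" and h: "h \<in> carrier G" and eq: "rep g = rep h"
  have mem: "inv g \<otimes> h \<in> V" if "V \<in> \<V>" for V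
    using rep_nbhd[OF that g h] eq rep_mem[OF h] \<phi>_mem that by simp
  have "inv g \<otimes> h = \<one>"
  proof (rule ccontr)
    assume "inv g \<otimes> h \<noteq> \<one>"
    then have "\<exists>A B. openin T A \<and> openin T B \<and> \<one> \<in> A \<and> inv g \<otimes> h \<in> B \<and> disjnt A B"
      using Hausdorff[unfolded Hausdorff_space_def, rule_format, of \<one> "inv g \<otimes> h"] g h topspace_eq
      by simp
    then obtain A where "openin T A" "\<one> \<in> A" "inv g \<otimes> h \<notin> A"
      by (auto simp: disjnt_iff)
    then show False using \<V>_nbhd mem by blast
  qed
  then have "g \<otimes> (inv g \<otimes> h) = g" using g by simp
  then show "g = h" using g h by (simp add: m_assoc[symmetric])
qed

text \<open>Pointwise convergence allows one \<open>u\<close> at a time to be treated. Replacing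
  \<open>u\<close> by a nearby \<open>\<phi> t\<close> costs two thirds of \<open>e\<close>, and
  invariance of the distance reduces the rest to continuity of the action at the identity.\<close>

lemma rep_continuous: "continuous_map T (Iso_topology U) rep"
proof -
  have "continuous_map T U.mtopology (\<lambda>g. rep g u)" if u: "u \<in> mspace U" for u
    unfolding U.continuous_map_to_metric
  proof (intro ballI allI impI)
    fix g and e :: real assume g: "g \<in> topspace T" and e: "0 < e"
    then have g: "g \<in> carrier G" using topspace_eq by simp
    obtain t where t: "t \<in> terms" "mdist U u (\<phi> t) < e / 3"
      using \<phi>_dense[OF u, of "e / 3"] e by auto
    obtain W where W: "openin T W" "\<one> \<in> W" "\<And>h. h \<in> W \<Longrightarrow> kdist t (act h t) < e / 3"
      using act_continuous_at_one[OF t(1), of "e / 3"] e by auto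
    let ?S = "{x \<in> carrier G. inv g \<otimes> x \<in> W}"
    have "rep x u \<in> U.mball (rep g u) e" if x: "x \<in> ?S" for x
    proof -
      have xG: "x \<in> carrier G" using x by simp
      have "act x t = act g (act (inv g \<otimes> x) t)"
        using act_mult[OF g _ t(1), of "inv g \<otimes> x"] g xG by (simp add: m_assoc[symmetric])
      then have "kdist (act g t) (act x t) < e / 3"
        using kdist_act[OF g t(1) act_terms[OF _ t(1)], of "inv g \<otimes> x"] W(3) x g by simp
      then have "mdist U (rep g (\<phi> t)) (rep x (\<phi> t)) < e / 3"
        using g xG t(1) by (simp add: rep_\<phi> \<phi>_dist act_terms)
      moreover have "mdist U (rep g u) (rep x u) \<le>
          mdist U (rep g u) (rep g (\<phi> t)) + mdist U (rep g (\<phi> t)) (rep x (\<phi> t)) + mdist U (rep x (\<phi> t)) (rep x u)"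
        using U.triangle[OF rep_mem[OF g u] rep_mem[OF g \<phi>_mem[OF t(1)]] rep_mem[OF xG u]]
          U.triangle[OF rep_mem[OF g \<phi>_mem[OF t(1)]] rep_mem[OF xG \<phi>_mem[OF t(1)]] rep_mem[OF xG u]]
        by simp
      ultimately show ?thesis
        using rep_dist[OF g u \<phi>_mem[OF t(1)]] rep_dist[OF xG \<phi>_mem[OF t(1)] u] t(2) U.commute[of u]
          rep_mem[OF g u] rep_mem[OF xG u] by simp
    qed
    moreover have "openin T ?S" using open_translate[OF W(1)] g by simp
    moreover have "g \<in> ?S" using g W(2) by simp
    ultimately show "\<exists>S. openin T S \<and> g \<in> S \<and> (\<forall>x\<in>S. rep x u \<in> U.mball (rep g u) e)"
      by blast
  qed
  then show ?thesis
    unfolding Iso_topology_def continuous_map_in_subtopology continuous_map_componentwise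
    using rep_Iso topspace_eq by (auto simp: mtopology_of_def rep_def)
qed

lemma evaluation_open:
  assumes "u \<in> mspace U" "v \<in> mspace U"
  shows "openin (Iso_topology U) {f \<in> carrier (Iso U). mdist U v (f u) < e}"
proof -
  have "continuous_map (Iso_topology U) U.mtopology (\<lambda>f. f u)"
    unfolding Iso_topology_def
    using continuous_map_product_projection[OF assms(1), of "\<lambda>_. mtopology_of U"]
    by (intro continuous_map_from_subtopology) (simp add: mtopology_of_def)
  from openin_continuous_map_preimage[OF this U.openin_mball[of v e]]
  have "openin (Iso_topology U) {f \<in> carrier (Iso U). f u \<in> U.mball v e}"
    by (simp add: topspace_Iso_topology)
  moreover have "f u \<in> mspace U" if "f \<in> carrier (Iso U)" for f
    using that assms(1) by (auto simp: Iso_def isometry_def)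
  ultimately show ?thesis
    using assms(2) by (auto simp: U.in_mball cong: conj_cong elim!: back_subst[where P = "openin _"])
qed

text \<open>A single evaluation is enough near \<open>g\<close>: if \<open>V\<close> translated by
  \<open>g\<close> lies in \<open>A\<close>, every \<open>rep h\<close> that sends the image of
  \<open>(V, \<one>)\<close> to within 1/2 of where \<open>rep g\<close> sends it has
  \<open>h\<close> in \<open>A\<close>.\<close>

lemma rep_open_map: "open_map T (subtopology (Iso_topology U) (rep ` carrier G)) rep"
  unfolding open_map_def
proof (intro allI impI)
  fix A assume A: "openin T A"
  show "openin (subtopology (Iso_topology U) (rep ` carrier G)) (rep ` A)"
  proof (subst openin_subopen, intro ballI)
    fix f assume "f \<in> rep ` A"
    then obtain g where g: "f = rep g" "g \<in> A" by blast
    then have gG: "g \<in> carrier G" using open_subset[OF A] by blast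
    obtain V where V: "V \<in> \<V>" "V \<subseteq> {x \<in> carrier G. g \<otimes> x \<in> A}"
      using \<V>_nbhd[OF open_translate[OF A gG]] gG g(2) by auto
    let ?u = "\<phi> (kterm.Base (V, \<one>))"
    have u: "?u \<in> mspace U" using V(1) by (simp add: \<phi>_mem)
    let ?S = "{f \<in> carrier (Iso U). mdist U (rep g ?u) (f ?u) < 1/2} \<inter> rep ` carrier G"
    have "openin (subtopology (Iso_topology U) (rep ` carrier G)) ?S"
      unfolding openin_subtopology using evaluation_open[OF u rep_mem[OF gG u]] by blast
    moreover have "f \<in> ?S"
      using g gG u rep_mem[OF gG u] rep_Iso by simp
    moreover have "?S \<subseteq> rep ` A"
    proof
      fix k assume "k \<in> ?S"
      then obtain h where h: "k = rep h" "h \<in> carrier G" "mdist U (rep g ?u) (rep h ?u) < 1/2"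
        by auto
      have "inv g \<otimes> h \<in> V" using rep_nbhd[OF V(1) gG h(2,3)] .
      then have "g \<otimes> (inv g \<otimes> h) \<in> A" using V(2) by blast
      then have "h \<in> A" using gG h(2) by (simp add: m_assoc[symmetric])
      then show "k \<in> rep ` A" using h(1) by blast
    qed
    ultimately show "\<exists>S. openin (subtopology (Iso_topology U) (rep ` carrier G)) S \<and> f \<in> S \<and> S \<subseteq> rep ` A"
      by blast
  qed
qed

lemma rep_embedding:
  "subgroup (rep ` carrier G) (Iso U)"
  "topological_group_iso G T ((Iso U)\<lparr>carrier := rep ` carrier G\<rparr>)
     (subtopology (Iso_topology U) (rep ` carrier G)) rep"
proof -
  interpret hom: group_hom G "Iso U" rep
    using rep_hom group_Iso by (simp add: group_hom_def group_hom_axioms_def is_group)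
  show "subgroup (rep ` carrier G) (Iso U)" by (rule hom.img_is_subgroup)
  have "rep \<in> iso G ((Iso U)\<lparr>carrier := rep ` carrier G\<rparr>)"
    using rep_inj by (auto simp: iso_def hom_def bij_betw_def)
  moreover have "homeomorphic_map T (subtopology (Iso_topology U) (rep ` carrier G)) rep"
  proof (rule bijective_open_imp_homeomorphic_map)
    show "continuous_map T (subtopology (Iso_topology U) (rep ` carrier G)) rep"
      using rep_continuous topspace_eq by (simp add: continuous_map_in_subtopology image_subset_iff_funcset)
    show "rep ` topspace T = topspace (subtopology (Iso_topology U) (rep ` carrier G))"
      using rep_Iso topspace_eq by (auto simp: topspace_Iso_topology)
  qed (use rep_open_map rep_inj topspace_eq in auto)
  ultimately show "topological_group_iso G T ((Iso U)\<lparr>carrier := rep ` carrier G\<rparr>)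
     (subtopology (Iso_topology U) (rep ` carrier G)) rep"
    by (simp add: topological_group_iso_def)
qed

end

theorem theorem6p2:
  fixes m :: "'k rel"
    and G :: "('g, 'b) monoid_scheme" and T :: "'g topology"
    and U :: "'u metric"
  assumes "Cinfinite m"
    and "is_cardinal_sup {m ^c n | n :: 'k rel. Card_order n \<and> n <o m} m"
    and "Urysohn_Katetov m U"
    and "topological_group G T" and "Hausdorff_space T"
    and "weight T =o m"
    and "P_space m T"
  shows "\<exists>H \<phi>. subgroup H (Iso U) \<and>
           topological_group_iso G T ((Iso U)\<lparr>carrier := H\<rparr>) (subtopology (Iso_topology U) H) \<phi>"
proof -
  interpret topgroup G T using assms(4) by unfold_locales
  interpret power_closed_cardinal m
    using assms(1,2) by unfold_locales (auto simp: is_cardinal_sup_def)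
  have weight: "weight T \<le>o m" using assms(6) by (rule ordIso_imp_ordLeq)
  obtain \<B> where \<B>: "base_of_topology T \<B>" "weight T = |\<B>|"
    by (rule weight_attained[of T])
  \<comment> \<open>Members of a smallest base that contain the identity: a neighbourhood base there
    of size at most m.\<close>
  define \<V> where "\<V> = {V \<in> \<B>. \<one>\<^bsub>G\<^esub> \<in> V}"
  have "\<exists>\<nu>. \<nu> \<one>\<^bsub>G\<^esub> = (0::real) \<and> (\<forall>g\<in>carrier G. 0 \<le> \<nu> g \<and> \<nu> g \<le> 1 \<and> \<nu> (inv\<^bsub>G\<^esub> g) = \<nu> g \<and> (\<nu> g < 1/2 \<longrightarrow> g \<in> V)) \<and>
      (\<forall>g\<in>carrier G. \<forall>h\<in>carrier G. \<nu> (g \<otimes>\<^bsub>G\<^esub> h) \<le> \<nu> g + \<nu> h) \<and>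
      (\<forall>e>0. \<exists>W. openin T W \<and> \<one>\<^bsub>G\<^esub> \<in> W \<and> (\<forall>g\<in>W. \<nu> g < e))" if V: "V \<in> \<V>" for V
  proof -
    have "openin T V" "\<one>\<^bsub>G\<^esub> \<in> V" using V \<B>(1) by (auto simp: \<V>_def base_of_topology_def)
    from ex_norm[OF this] show ?thesis by metis
  qed
  then obtain N where N: "\<forall>V\<in>\<V>. N V \<one>\<^bsub>G\<^esub> = (0::real) \<and>
      (\<forall>g\<in>carrier G. 0 \<le> N V g \<and> N V g \<le> 1 \<and> N V (inv\<^bsub>G\<^esub> g) = N V g \<and> (N V g < 1/2 \<longrightarrow> g \<in> V)) \<and>
      (\<forall>g\<in>carrier G. \<forall>h\<in>carrier G. N V (g \<otimes>\<^bsub>G\<^esub> h) \<le> N V g + N V h) \<and>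
      (\<forall>e>0. \<exists>W. openin T W \<and> \<one>\<^bsub>G\<^esub> \<in> W \<and> (\<forall>g\<in>W. N V g < e))"
    by metis
  interpret normed_P_group G T m \<V> N
  proof
    show "P_space m T" "Hausdorff_space T" "weight T \<le>o m" by fact+
    show "|\<V>| \<le>o m"
      using weight[unfolded \<B>(2)] by (intro card_subset_le[of \<V> \<B>]) (auto simp: \<V>_def)
    show "\<exists>W\<in>\<V>. W \<subseteq> V" if "openin T V" "\<one>\<^bsub>G\<^esub> \<in> V" for V
      using \<B>(1) that unfolding base_of_topology_def \<V>_def by blast
  qed (use N in blast)+
  show ?thesis
  proof (rule ex_dense_isometry[OF assms(3)])
    fix \<phi> :: "('g set \<times> 'g, 'k) kterm \<Rightarrow> 'u"
    assume \<phi>: "\<And>t. t \<in> terms \<Longrightarrow> \<phi> t \<in> mspace U"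
      "\<And>t t'. t \<in> terms \<Longrightarrow> t' \<in> terms \<Longrightarrow> mdist U (\<phi> t) (\<phi> t') = kdist t t'"
      "\<And>u e. u \<in> mspace U \<Longrightarrow> 0 < e \<Longrightarrow> \<exists>t\<in>terms. mdist U u (\<phi> t) < e"
    have complete: "mcomplete_of U" using assms(3) by (simp add: Urysohn_Katetov_def)
    interpret dense_isometry G T m \<V> N U \<phi>
      using complete \<phi> by unfold_locales
    show ?thesis using rep_embedding by blast
  qed
qed

end
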